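(* Let the setting, notation and standing assumptions be those of the context. Suppose that: (a) $\|A_{cl}(x)-A_{cl}(y)\|\le L_{cl}\|x-y\|$ for all $x,y\in\Omega$, with $L_{cl}>0$; (b) the pair $(A(x),B)$ is stabilizable for every $x\in\Omega$; (c) the pair $(A(x),Q^{1/2})$ is detectable for every $x\in\Omega$; (d) $y_0:\mathcal P\to\mathbb R^d$ is Lipschitz continuous with constant $L_{y_0}>0$; (e) $\|A(x)-A(y)\|\le L_A\|x-y\|$ for all $x,y\in\Omega$, with $L_A>0$. Let $\mu\in\mathcal P$ and $\tilde\mu=\mu+\Delta\mu\in\mathcal P$ with $\Delta\mu>0$, and let $$L=\max_{x\in\Omega}\operatorname{logm}(A_{cl}(x))+L_{cl}\max_{y\in\Omega}\|y\|.$$ (i) If $$\Delta\mu<\frac{1}{2L_AL_{y_0}\|H_{\mu,0}\|},\qquad (1)$$ then $A_{\tilde\mu,0}-FP_{\mu,0}$ is stable. (ii) If moreover $$L<-\frac1t\log\big(2L_AL_{y_0}\,\Delta\mu\,\|H_{\mu,t}\|\big)\quad\text{for all }t\in(0,T],\qquad (2)$$ then $A_{\tilde\mu,t}-FP_{\mu,t}$ is stable for all $t\in[0,T]$. (iii) If (1) and (2) hold, then for every $t\in[0,T]$ the Newton--Kleinman sequence $\{P^j_{\tilde\mu,t}\}_{j\ge0}$ for the parameter $\tilde\mu$ at time $t$ with initial guess $P^0_{\tilde\mu,t}=P_{\mu,t}$ converges to the unique symmetric positive semidefinite solution $P_{\tilde\mu,t}$ of the Riccati equation $$A_{\tilde\mu,t}^\top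 P+PA_{\tilde\mu,t}-PFP+Q=0.$$
   Context: Let $d,m\in\mathbb N$, $T>0$, $\Omega\subset\mathbb R^d$ a domain, $\mathcal P\subset\mathbb R$ a (one-dimensional) parameter set. $\|\cdot\|$ is the Euclidean norm for vectors and the operator 2-norm for matrices. Let $A:\mathbb R^d\to\mathbb R^{d\times d}$ be a matrix function, $B\in\mathbb R^{d\times m}$, $Q\in\mathbb R^{d\times d}$ symmetric positive semidefinite, $R\in\mathbb R^{m\times m}$ symmetric positive definite, and $F=BR^{-1}B^\top$. A real square matrix is stable if all its eigenvalues lie in the open left half plane. A pair $(A,B)$ is stabilizable if there is a matrix $K$ such that $A-BK$ is stable; $(A,C)$ is detectable if $(A^\top,C^\top)$ is stabilizable. For $y\in\Omega$, $P(y)$ denotes the unique symmetric positive semidefinite solution of the State-Dependent Riccati Equation $A(y)^\top P(y)+P(y)A(y)-P(y)FP(y)+Q=0$, which exists under stabilizability of $(A(y),B)$ and detectability of $(A(y),Q^{1/2})$ and for which $A(y)-FP(y)$ is stable. The closed-loop matrix is $A_{cl}(y)=A(y)-FP(y)$. For $\mu\in\mathcal P$, $y(\cdot;\mu)$ is the solution of $\dot y(t;\mu)=A_{cl}(y(t;\mu))\,y(t;\mu)$, $y(0;\mu)=y_0(\mu)$; the trajectories considered are assumed to exist and remain in $\Omega$ for $t\in[0,T]$. Notation: $y_{\mu,t}=y(t;\mu)$, $A_{\mu,t}=A(y_{\mu,t})$, $P_{\mu,t}=P(y_{\mu,t})$. The matrix $H_{\mu,t}$ is the solution of the Lyapunov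 equation $$(A_{\mu,t}-FP_{\mu,t})^\top H_{\mu,t}+H_{\mu,t}(A_{\mu,t}-FP_{\mu,t})=-I.$$ The logarithmic norm of $M\in\mathbb C^{d\times d}$ is $\operatorname{logm}(M)=\sup_{x\in\mathbb C^d\setminus\{0\}}\operatorname{Re}((Mx)\cdot x)/\|x\|^2$, where $\cdot$ is the standard Hermitian inner product. The maxima over $\Omega$ defining $L$ are assumed to exist. Newton--Kleinman sequence at $(\mu,t)$ with initial guess $P^0_{\mu,t}$: given $P^k_{\mu,t}$, set $A^k_{cl}=A_{\mu,t}-FP^k_{\mu,t}$ and let $P^{k+1}_{\mu,t}$ be the solution of the Lyapunov equation $(A^k_{cl})^\top P^{k+1}_{\mu,t}+P^{k+1}_{\mu,t}A^k_{cl}=-P^k_{\mu,t}FP^k_{\mu,t}-Q$. *)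

theory Defs
  imports "HOL-Analysis.Analysis"
begin

(* The type class norm on real^'m^'n is the Frobenius norm, hence a separate operator 2-norm. *)
definition opnorm :: "real^'m^'n \<Rightarrow> real" where
  "opnorm M = onorm ((*v) M)"

definition sym_psd :: "real^'n^'n \<Rightarrow> bool" where
  "sym_psd M \<longleftrightarrow> transpose M = M \<and> (\<forall>x. 0 \<le> x \<bullet> (M *v x))"

definition sym_pd :: "real^'n^'n \<Rightarrow> bool" where
  "sym_pd M \<longleftrightarrow> transpose M = M \<and> (\<forall>x. x \<noteq> 0 \<longrightarrow> 0 < x \<bullet> (M *v x))"

definition psd_sqrt :: "real^'n^'n \<Rightarrow> real^'n^'n" where
  "psd_sqrt M = (THE S. sym_psd S \<and> S ** S = M)"

definition complex_mat :: "real^'m^'n \<Rightarrow> complex^'m^'n" where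
  "complex_mat M = map_matrix complex_of_real M"

definition eigenvalue :: "complex^'n^'n \<Rightarrow> complex \<Rightarrow> bool" where
  "eigenvalue M l \<longleftrightarrow> (\<exists>v. v \<noteq> 0 \<and> M *v v = l *s v)"

definition stable_mat :: "real^'n^'n \<Rightarrow> bool" where
  "stable_mat M \<longleftrightarrow> (\<forall>l. eigenvalue (complex_mat M) l \<longrightarrow> Re l < 0)"

definition stabilizable :: "real^'n^'n \<Rightarrow> real^'m^'n \<Rightarrow> bool" where
  "stabilizable A B \<longleftrightarrow> (\<exists>K. stable_mat (A - B ** K))"

definition detectable :: "real^'n^'n \<Rightarrow> real^'n^'p \<Rightarrow> bool" where
  "detectable A C \<longleftrightarrow> stabilizable (transpose A) (transpose C)"

(* The inner product of HOL-Analysis on complex^'n is real-valued, so the Hermitian product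
   is written out. *)
definition logm :: "complex^'n^'n \<Rightarrow> real" where
  "logm M = (SUP x \<in> UNIV - {0}. Re (\<Sum>i\<in>UNIV. (M *v x) $ i * cnj (x $ i)) / (norm x)\<^sup>2)"

definition riccati_eq :: "real^'n^'n \<Rightarrow> real^'n^'n \<Rightarrow> real^'n^'n \<Rightarrow> real^'n^'n \<Rightarrow> bool" where
  "riccati_eq A F Q P \<longleftrightarrow> transpose A ** P + P ** A - P ** F ** P + Q = 0"

(* Meaningful when (A, B) is stabilizable and (A, psd_sqrt Q) is detectable, where
   F = B R^-1 B^T: then exactly one such P exists. *)
definition riccati_sol :: "real^'n^'n \<Rightarrow> real^'n^'n \<Rightarrow> real^'n^'n \<Rightarrow> real^'n^'n" where
  "riccati_sol A F Q = (THE P. sym_psd P \<and> riccati_eq A F Q P)"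

definition lyapunov_eq :: "real^'n^'n \<Rightarrow> real^'n^'n \<Rightarrow> real^'n^'n \<Rightarrow> bool" where
  "lyapunov_eq M C X \<longleftrightarrow> transpose M ** X + X ** M = C"

(* Meaningful when M is stable: then exactly one solution exists. *)
definition lyapunov_sol :: "real^'n^'n \<Rightarrow> real^'n^'n \<Rightarrow> real^'n^'n" where
  "lyapunov_sol M C = (THE X. lyapunov_eq M C X)"

primrec newton_kleinman ::
    "real^'n^'n \<Rightarrow> real^'n^'n \<Rightarrow> real^'n^'n \<Rightarrow> real^'n^'n \<Rightarrow> nat \<Rightarrow> real^'n^'n" where
  "newton_kleinman A F Q P0 0 = P0"
| "newton_kleinman A F Q P0 (Suc k) =
     (let Pk = newton_kleinman A F Q P0 k
      in lyapunov_sol (A - F ** Pk) (- (Pk ** F ** Pk) - Q))"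

(* A domain is a nonempty connected open set, to which boundary points may be added. The latter
   is needed for the maximum of the norm over the set to be attainable: on an open nonempty set
   in positive dimension it never is. *)
definition is_domain :: "'a::topological_space set \<Rightarrow> bool" where
  "is_domain S \<longleftrightarrow>
     (\<exists>U. open U \<and> connected U \<and> U \<noteq> {} \<and> U \<subseteq> S \<and> S \<subseteq> closure U)"

end

theory Submission
  imports Defs "HOL-Computational_Algebra.Fundamental_Theorem_Algebra"
begin

text \<open>
The three claims rest on one perturbation bound and on the classical theory of the algebraic
Riccati equation, which is developed here from scratch.

Stability of the reused feedback: let \<open>M = A_{\<mu>,t} - F P_{\<mu>,t}\<close>, which is stable, and let \<open>H\<close> solve
\<open>M\<^sup>T H + H M = - I\<close>. Replacing \<open>M\<close> by \<open>M + E\<close> changes the right-hand side to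
\<open>- I + E\<^sup>T H + H E\<close>, which is still negative definite when \<open>2 \<parallel>E\<parallel> \<parallel>H\<parallel> < 1\<close>; hence \<open>M + E\<close> is
stable (\<open>stable_mat_perturb\<close>). Here \<open>E\<close> is the difference of \<open>A\<close> at two states, so its norm
is at most \<open>L_A\<close> times the distance of the two trajectories. The latter satisfies
\<open>(w' - y') \<bullet> (w - y) \<le> L \<parallel>w - y\<parallel>\<^sup>2\<close>, and Gronwall's argument bounds it by \<open>exp (L t)\<close> times the
initial distance (\<open>trajectory_divergence\<close>). The two smallness hypotheses, the first at \<open>t = 0\<close>
and the second at \<open>t > 0\<close>, say that the resulting bound on \<open>2 \<parallel>E\<parallel> \<parallel>H\<parallel>\<close> is less than 1.

Convergence of the iteration: it now starts from a stabilizing matrix, so it suffices to prove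
Kleinman's theorem. If \<open>X\<close> is the cost of a stabilizing gain \<open>K\<close>, then completing the square shows
that the gain \<open>R\<^sup>-\<^sup>1 B\<^sup>T X\<close> is stabilizing again and not more expensive
(\<open>policy_improvement_stable\<close>, \<open>newton_kleinman_decreasing\<close>). The iterates therefore decrease in the
Loewner order, are bounded below by 0, and converge to a positive semidefinite solution of the Riccati
equation. Detectability makes every such solution stabilizing, and a stabilizing solution dominates
every other symmetric one, whence uniqueness (\<open>riccati_ex1\<close>).

Underneath lies Lyapunov's theory for a stable \<open>M\<close>, obtained without matrix exponentials. Unique
solvability of \<open>M\<^sup>T X + X M = C\<close> is linear algebra (\<open>sylvester_homogeneous\<close>). That
\<open>C \<le> 0\<close> implies \<open>X \<ge> 0\<close> (\<open>lyapunov_sign\<close>) follows by a continuity argument in the shift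
\<open>M - t I\<close> (\<open>lyapunov_certificate\<close>).
\<close>

section \<open>Real matrices and their quadratic forms\<close>

declare transpose_matrix_vector [simp del]

lemma mat_vector_scaleR: "mat t *v x = t *\<^sub>R x" for x :: "real^'n"
  by (simp add: vec_eq_iff matrix_vector_mult_def mat_def if_distrib[of "\<lambda>x. x * _"] cong: if_cong)

lemma inner_transpose:
  fixes M :: "real^'n^'m"
  shows "x \<bullet> (transpose M *v z) = (M *v x) \<bullet> z"
  by (metis dot_lmul_matrix inner_commute transpose_matrix_vector)

lemma transpose_add: "transpose (X + Y) = transpose X + transpose Y"
  by (simp add: transpose_def vec_eq_iff)

lemma transpose_diff: "transpose (X - Y) = transpose X - transpose Y"
  by (simp add: transpose_def vec_eq_iff)

lemma transpose_uminus: "transpose (- X) = - transpose X"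
  by (simp add: transpose_def vec_eq_iff)

lemma transpose_zero: "transpose 0 = 0"
  by (simp add: transpose_def vec_eq_iff zero_vec_def)

lemma matrix_add_rdistrib: "(M + N) ** X = M ** X + N ** X" for X :: "'a::semiring_1^'n^'p"
  by (simp add: matrix_matrix_mult_def vec_eq_iff distrib_right sum.distrib)

lemma matrix_diff_rdistrib: "(M - N) ** X = M ** X - N ** X" for X :: "'a::ring_1^'n^'p"
  by (simp add: matrix_matrix_mult_def vec_eq_iff left_diff_distrib sum_subtractf)

lemma matrix_diff_ldistrib: "X ** (M - N) = X ** M - X ** N" for X :: "'a::ring_1^'n^'p"
  by (simp add: matrix_matrix_mult_def vec_eq_iff right_diff_distrib sum_subtractf)

lemma matrix_mul_rzero: "X ** 0 = 0" for X :: "'a::ring_1^'n^'p"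
  by (simp add: matrix_matrix_mult_def vec_eq_iff)

lemma matrix_uminus_mult: "(- M) ** X = - (M ** X)" for X :: "'a::ring_1^'n^'p"
  by (simp add: matrix_matrix_mult_def vec_eq_iff sum_negf)

lemma uminus_matrix_vector: "(- M) *v x = - (M *v x)" for M :: "'a::ring_1^'n^'m"
  by (simp add: matrix_vector_mult_def vec_eq_iff sum_negf)

lemma inner_sym_matrix:
  fixes X :: "real^'n^'n"
  assumes "transpose X = X"
  shows "x \<bullet> (X *v z) = (X *v x) \<bullet> z"
  using inner_transpose[of x X z] assms by simp

text \<open>
For a symmetric \<open>X\<close> the condition that \<open>M\<^sup>T X + X M\<close> is negative (semi)definite can be read as a
sign of \<open>(M x) \<bullet> (X x)\<close>. All sign conditions below are stated in this form, which keeps products of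
matrices out of the calculations.
\<close>
lemma lyapunov_form:
  fixes X :: "real^'n^'n"
  assumes "transpose X = X"
  shows "x \<bullet> ((transpose M ** X + X ** M) *v x) = 2 * ((M *v x) \<bullet> (X *v x))"
  using assms
  by (simp add: matrix_vector_mult_add_rdistrib inner_add_right inner_transpose inner_sym_matrix
      inner_commute[of "X *v x"] flip: matrix_vector_mul_assoc)

text \<open>
A zero of a nonnegative quadratic form is a minimum, so the gradient \<open>2 X x\<close> vanishes there. The
proof moves from \<open>x\<close> a small step along \<open>- X x\<close>.
\<close>
lemma sym_psd_kernel:
  assumes X: "sym_psd X" and z: "x \<bullet> (X *v x) = 0"
  shows "X *v x = 0"
proof -
  let ?w = "X *v x"
  have sym: "transpose X = X" and pos: "\<And>u. 0 \<le> u \<bullet> (X *v u)"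
    using X by (auto simp: sym_psd_def)
  have q: "0 \<le> 2 * s * (?w \<bullet> ?w) + s\<^sup>2 * (?w \<bullet> (X *v ?w))" for s
  proof -
    have "0 \<le> (x + s *\<^sub>R ?w) \<bullet> (X *v (x + s *\<^sub>R ?w))" by (rule pos)
    also have "\<dots> = 2 * s * (?w \<bullet> ?w) + s\<^sup>2 * (?w \<bullet> (X *v ?w))"
      using z inner_sym_matrix[OF sym, of x ?w]
      by (simp add: matrix_vector_right_distrib matrix_vector_mult_scaleR inner_add_left
          inner_add_right power2_eq_square algebra_simps)
    finally show ?thesis .
  qed
  let ?c = "?w \<bullet> (X *v ?w)"
  have "?w \<bullet> ?w = 0"
  proof (rule ccontr)
    assume "?w \<bullet> ?w \<noteq> 0"
    then have w: "?w \<bullet> ?w > 0" by simp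
    have c: "?c \<ge> 0" by (rule pos)
    \<comment> \<open>any sufficiently small negative step makes the linear term dominate\<close>
    define s where "s = - (?w \<bullet> ?w) / (?c + 1)"
    have s: "s < 0" unfolding s_def using w c by (simp add: divide_neg_pos)
    have "s * ?c \<ge> - (?w \<bullet> ?w)"
      unfolding s_def using w c by (simp add: field_simps)
    then have "2 * (?w \<bullet> ?w) + s * ?c > 0" using w by linarith
    then have "s * (2 * (?w \<bullet> ?w) + s * ?c) < 0" using s by (simp add: mult_neg_pos)
    then show False using q[of s] by (simp add: power2_eq_square algebra_simps)
  qed
  then show ?thesis by simp
qed

lemma symmetric_matrix_eq_0:
  fixes X :: "real^'n^'n"
  assumes sym: "transpose X = X" and z: "\<And>x. x \<bullet> (X *v x) = 0"
  shows "X = 0"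
proof -
  have "sym_psd X" using assms by (simp add: sym_psd_def)
  then have "X *v x = 0 *v x" for x using sym_psd_kernel[OF _ z] by simp
  then show ?thesis by (metis matrix_eq)
qed

section \<open>Eigenvalues of real matrices\<close>

lemma complex_mat_mult: "complex_mat (M ** N) = complex_mat M ** complex_mat N"
  by (simp add: complex_mat_def vec_eq_iff matrix_matrix_mult_def)

lemma complex_mat_transpose: "complex_mat (transpose M) = transpose (complex_mat M)"
  by (simp add: complex_mat_def vec_eq_iff transpose_def)

lemma complex_mat_uminus: "complex_mat (- M) = - complex_mat M"
  by (simp add: complex_mat_def vec_eq_iff)

lemma complex_mat_eq_0: "complex_mat M = 0 \<longleftrightarrow> M = 0"
  by (simp add: complex_mat_def vec_eq_iff)

lemma Re_complex_mat_mult: "Re ((complex_mat M *v v) $ i) = (M *v (\<chi> j. Re (v $ j))) $ i"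
  by (simp add: complex_mat_def matrix_vector_mult_def)

lemma Im_complex_mat_mult: "Im ((complex_mat M *v v) $ i) = (M *v (\<chi> j. Im (v $ j))) $ i"
  by (simp add: complex_mat_def matrix_vector_mult_def)

text \<open>
Splitting an eigenvector into its real part \<open>a\<close> and imaginary part \<open>b\<close> allows arguments about
stability to stay within real matrices.
\<close>
lemma eigenvalue_complex_mat_iff:
  "eigenvalue (complex_mat M) l \<longleftrightarrow>
     (\<exists>a b. (a \<noteq> 0 \<or> b \<noteq> 0) \<and> M *v a = Re l *\<^sub>R a - Im l *\<^sub>R b
                            \<and> M *v b = Im l *\<^sub>R a + Re l *\<^sub>R b)"
proof
  assume "eigenvalue (complex_mat M) l"
  then obtain v where v: "v \<noteq> 0" "complex_mat M *v v = l *s v"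
    unfolding eigenvalue_def by blast
  let ?a = "\<chi> j. Re (v $ j)" and ?b = "\<chi> j. Im (v $ j)"
  have "?a \<noteq> 0 \<or> ?b \<noteq> 0"
    using v(1) by (auto simp: vec_eq_iff complex_eq_iff)
  moreover have "M *v ?a = Re l *\<^sub>R ?a - Im l *\<^sub>R ?b"
    unfolding vec_eq_iff using v(2) by (simp flip: Re_complex_mat_mult)
  moreover have "M *v ?b = Im l *\<^sub>R ?a + Re l *\<^sub>R ?b"
    unfolding vec_eq_iff using v(2) by (simp flip: Im_complex_mat_mult)
  ultimately show "\<exists>a b. (a \<noteq> 0 \<or> b \<noteq> 0) \<and> M *v a = Re l *\<^sub>R a - Im l *\<^sub>R b
                            \<and> M *v b = Im l *\<^sub>R a + Re l *\<^sub>R b" by blast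
next
  assume "\<exists>a b. (a \<noteq> 0 \<or> b \<noteq> 0) \<and> M *v a = Re l *\<^sub>R a - Im l *\<^sub>R b
                            \<and> M *v b = Im l *\<^sub>R a + Re l *\<^sub>R b"
  then obtain a b where ab: "a \<noteq> 0 \<or> b \<noteq> 0" "M *v a = Re l *\<^sub>R a - Im l *\<^sub>R b"
    "M *v b = Im l *\<^sub>R a + Re l *\<^sub>R b" by blast
  define v where "v = (\<chi> j. Complex (a $ j) (b $ j))"
  have re: "(\<chi> j. Re (v $ j)) = a" and im: "(\<chi> j. Im (v $ j)) = b"
    by (simp_all add: v_def vec_eq_iff)
  have "v \<noteq> 0" using ab(1) by (auto simp: v_def vec_eq_iff complex_eq_iff)
  moreover have "complex_mat M *v v = l *s v"
    unfolding vec_eq_iff complex_eq_iff Re_complex_mat_mult Im_complex_mat_mult re im ab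
    by (simp add: v_def)
  ultimately show "eigenvalue (complex_mat M) l" unfolding eigenvalue_def by blast
qed

lemma stable_matI:
  assumes "\<And>l a b. a \<noteq> 0 \<or> b \<noteq> 0 \<Longrightarrow> M *v a = Re l *\<^sub>R a - Im l *\<^sub>R b \<Longrightarrow>
             M *v b = Im l *\<^sub>R a + Re l *\<^sub>R b \<Longrightarrow> Re l < 0"
  shows "stable_mat M"
  using assms unfolding stable_mat_def eigenvalue_complex_mat_iff by blast

lemma stable_matD:
  assumes "stable_mat M" "a \<noteq> 0 \<or> b \<noteq> 0" "M *v a = Re l *\<^sub>R a - Im l *\<^sub>R b"
    "M *v b = Im l *\<^sub>R a + Re l *\<^sub>R b"
  shows "Re l < 0"
  using assms unfolding stable_mat_def eigenvalue_complex_mat_iff by blast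

lemma matrix_vector_mat: "mat c *v v = c *s v" for v :: "complex^'n"
  by (simp add: vec_eq_iff matrix_vector_mult_def mat_def if_distrib[of "\<lambda>x. x * _"] cong: if_cong)

lemma eigenvalue_iff_det: "eigenvalue M l \<longleftrightarrow> det (M - mat l) = 0"
proof -
  have "eigenvalue M l \<longleftrightarrow> (\<exists>v. v \<noteq> 0 \<and> (M - mat l) *v v = 0)"
    by (simp add: eigenvalue_def matrix_vector_mult_diff_rdistrib matrix_vector_mat)
  also have "\<dots> \<longleftrightarrow> \<not> invertible (M - mat l)"
    unfolding invertible_left_inverse matrix_left_invertible_ker by blast
  finally show ?thesis by (simp add: invertible_det_nz)
qed

lemma eigenvalue_transpose: "eigenvalue (transpose M) l \<longleftrightarrow> eigenvalue M l"
proof -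
  have "transpose M - mat l = transpose (M - mat l)" by (simp add: transpose_diff)
  then show ?thesis by (simp add: eigenvalue_iff_det)
qed

lemma eigenvalue_uminus: "eigenvalue (- M) l \<longleftrightarrow> eigenvalue M (- l)"
proof -
  have "(- M) *v v = l *s v \<longleftrightarrow> M *v v = (- l) *s v" for v :: "complex^'a"
    using minus_equation_iff[of "M *v v" "l *s v"] by (auto simp: uminus_matrix_vector)
  then show ?thesis by (simp add: eigenvalue_def)
qed

lemma stable_mat_transpose: "stable_mat (transpose M) \<longleftrightarrow> stable_mat M"
  by (simp add: stable_mat_def complex_mat_transpose eigenvalue_transpose)

section \<open>Homogeneous Sylvester equations\<close>

text \<open>
The vector \<open>p(M) v\<close>, evaluated by Horner's scheme with matrix-vector products.
\<close>
definition poly_mat_vec :: "complex^'n^'n \<Rightarrow> complex poly \<Rightarrow> complex^'n \<Rightarrow> complex^'n" where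
  "poly_mat_vec M p v = fold_coeffs (\<lambda>a w. a *s v + M *v w) p 0"

lemma poly_mat_vec_0: "poly_mat_vec M 0 v = 0"
  by (simp add: poly_mat_vec_def)

lemma poly_mat_vec_pCons: "poly_mat_vec M (pCons a p) v = a *s v + M *v poly_mat_vec M p v"
  by (cases "p = 0 \<and> a = 0") (auto simp: poly_mat_vec_def)

lemma complex_matrix_vector_smult: "M *v (c *s v) = c *s (M *v v)" for M :: "complex^'n^'m"
  by (simp add: vec_eq_iff matrix_vector_mult_def sum_distrib_left mult_ac)

lemma poly_mat_vec_add: "poly_mat_vec M (p + q) v = poly_mat_vec M p v + poly_mat_vec M q v"
  by (induction p q rule: poly_induct2)
     (simp_all add: poly_mat_vec_0 poly_mat_vec_pCons vector_sadd_rdistrib matrix_vector_right_distrib)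

lemma poly_mat_vec_smult: "poly_mat_vec M (smult c p) v = c *s poly_mat_vec M p v"
  by (induction p)
     (simp_all add: poly_mat_vec_0 poly_mat_vec_pCons complex_matrix_vector_smult vector_smult_assoc vector_add_ldistrib)

lemma poly_mat_vec_commute: "poly_mat_vec M p (M *v v) = M *v poly_mat_vec M p v"
  by (induction p) (simp_all add: poly_mat_vec_0 poly_mat_vec_pCons complex_matrix_vector_smult matrix_vector_right_distrib)

lemma poly_mat_vec_diff_smult:
  "poly_mat_vec M p (v - c *s w) = poly_mat_vec M p v - c *s poly_mat_vec M p w"
  by (induction p)
     (simp_all add: poly_mat_vec_0 poly_mat_vec_pCons complex_matrix_vector_smult matrix_vector_right_distrib
      matrix_vector_mult_diff_distrib vector_smult_assoc vector_add_ldistrib vector_ssub_ldistrib mult_ac)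

lemma poly_mat_vec_linear_factor:
  "poly_mat_vec M ([:- c, 1:] * p) v = M *v poly_mat_vec M p v - c *s poly_mat_vec M p v"
  "poly_mat_vec M ([:- c, 1:] * p) v = poly_mat_vec M p (M *v v - c *s v)"
proof -
  have "[:- c, 1:] * p = smult (- c) p + pCons 0 p" by simp
  then show "poly_mat_vec M ([:- c, 1:] * p) v = M *v poly_mat_vec M p v - c *s poly_mat_vec M p v"
    by (simp only: poly_mat_vec_add poly_mat_vec_smult poly_mat_vec_pCons) simp
  then show "poly_mat_vec M ([:- c, 1:] * p) v = poly_mat_vec M p (M *v v - c *s v)"
    by (simp add: poly_mat_vec_diff_smult poly_mat_vec_commute)
qed

lemma poly_mat_vec_monom: "poly_mat_vec M (monom c n) v = c *s (((*v) M ^^ n) v)"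
  by (induction n) (simp_all add: poly_mat_vec_0 poly_mat_vec_pCons monom_0 monom_Suc complex_matrix_vector_smult)

lemma poly_mat_vec_sum: "poly_mat_vec M (sum f S) v = (\<Sum>i\<in>S. poly_mat_vec M (f i) v)"
  by (induction S rule: infinite_finite_induct) (simp_all add: poly_mat_vec_0 poly_mat_vec_add)

text \<open>
The vectors \<open>v, M v, M\<^sup>2 v, \<dots>\<close> are linearly dependent because the dimension is finite.
\<close>
lemma exists_annihilating_poly:
  obtains p where "p \<noteq> 0" "poly_mat_vec M p v = 0"
proof -
  let ?f = "\<lambda>n. ((*v) M ^^ n) v"
  show ?thesis
  proof (cases "inj ?f")
    case False
    then obtain i j where ij: "i \<noteq> j" "?f i = ?f j" by (auto simp: inj_def)
    let ?p = "monom 1 i + monom (- 1) j :: complex poly"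
    have "coeff ?p i = 1" using ij(1) by simp
    then have "?p \<noteq> 0" by (metis coeff_0 zero_neq_one)
    moreover have "poly_mat_vec M ?p v = 0"
      using ij(2) by (simp add: poly_mat_vec_add poly_mat_vec_monom)
    ultimately show ?thesis by (rule that)
  next
    case True
    then have "infinite (range ?f)" using finite_imageD infinite_UNIV_nat by blast
    then have "vec.dependent (range ?f)" using vec.independent_explicit by blast
    then obtain t u where t: "finite t" "t \<subseteq> range ?f" "(\<Sum>w\<in>t. u w *s w) = 0" "\<exists>w\<in>t. u w \<noteq> 0"
      unfolding vec.dependent_explicit by blast
    obtain S where S: "finite S" "t = ?f ` S"
      using finite_subset_image[OF t(1,2)] by auto
    let ?p = "\<Sum>n\<in>S. monom (u (?f n)) n"
    have inj: "inj_on ?f S" using True by (auto intro: inj_on_subset)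
    obtain m where m: "m \<in> S" "u (?f m) \<noteq> 0" using t(4) S by auto
    have "coeff ?p m = u (?f m)" using m(1) S(1) by (simp add: coeff_sum)
    then have "?p \<noteq> 0" using m(2) by auto
    moreover have "poly_mat_vec M ?p v = 0"
      using t(3) S(2) inj by (simp add: poly_mat_vec_sum poly_mat_vec_monom sum.reindex)
    ultimately show ?thesis by (rule that)
  qed
qed

text \<open>
Any nonzero polynomial \<open>p\<close> with \<open>p(M) v = 0\<close> forces \<open>X v = 0\<close>, by induction on the degree. A root \<open>c\<close>
of \<open>p\<close> fails to be an eigenvalue of at least one of \<open>M\<close> and \<open>N\<close>. In the former case the factor \<open>M - c\<close> can be
cancelled on the left of \<open>p(M) v\<close>. In the latter case the induction hypothesis for \<open>(M - c) v\<close> gives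
\<open>(N - c) X v = X (M - c) v = 0\<close>, and \<open>N - c\<close> is injective.
\<close>
lemma sylvester_homogeneous:
  fixes M N X :: "complex^'n^'n"
  assumes comm: "X ** M = N ** X" and disj: "\<And>l. eigenvalue M l \<Longrightarrow> \<not> eigenvalue N l"
  shows "X = 0"
proof -
  have XM: "X *v (M *v v) = N *v (X *v v)" for v
    by (simp add: comm matrix_vector_mul_assoc)
  have kill: "X *v v = 0" if "p \<noteq> 0" "poly_mat_vec M p v = 0" for p v
    using that
  proof (induction "degree p" arbitrary: p v rule: less_induct)
    case less
    show ?case
    proof (cases "degree p = 0")
      case True
      then obtain a where "p = [:a:]" by (rule degree_eq_zeroE)
      then have "a \<noteq> 0" "a *s v = 0" using less.prems by (simp_all add: poly_mat_vec_0 poly_mat_vec_pCons)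
      then show ?thesis by simp
    next
      case False
      then have "\<not> constant (poly p)" by (simp add: constant_degree)
      then obtain c where "poly p c = 0" using fundamental_theorem_of_algebra by blast
      then obtain q where q: "p = [:- c, 1:] * q" by (auto simp: poly_eq_0_iff_dvd)
      have q0: "q \<noteq> 0" using q less.prems(1) by auto
      then have deg: "degree q < degree p" using q by (simp add: degree_mult_eq del: mult_pCons_left)
      show ?thesis
      proof (cases "eigenvalue N c")
        case True
        then have "\<not> eigenvalue M c" using disj by blast
        moreover have "M *v poly_mat_vec M q v = c *s poly_mat_vec M q v"
          using less.prems(2) by (simp only: q poly_mat_vec_linear_factor(1)) simp
        ultimately have "poly_mat_vec M q v = 0" unfolding eigenvalue_def by blast
        then show ?thesis using less.hyps[OF deg q0] by blast
      next
        case False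
        have "poly_mat_vec M q (M *v v - c *s v) = 0"
          using less.prems(2) by (simp only: q poly_mat_vec_linear_factor(2))
        then have "X *v (M *v v - c *s v) = 0" using less.hyps[OF deg q0] by blast
        then have "N *v (X *v v) = c *s (X *v v)"
          by (simp add: matrix_vector_mult_diff_distrib XM complex_matrix_vector_smult)
        then show ?thesis using False unfolding eigenvalue_def by blast
      qed
    qed
  qed
  have "X *v v = 0" for v
    using exists_annihilating_poly[of M v] kill by metis
  then show ?thesis by (metis matrix_eq matrix_vector_mult_0)
qed

text \<open>
The eigenvalues of \<open>M\<close> and of \<open>- M\<^sup>T\<close> are separated by the imaginary axis.
\<close>
lemma lyapunov_homogeneous:
  fixes M X :: "real^'n^'n"
  assumes M: "stable_mat M" and X: "transpose M ** X + X ** M = 0"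
  shows "X = 0"
proof -
  have "X ** M = - (transpose M ** X)" using X by (simp add: add_eq_0_iff)
  also have "\<dots> = (- transpose M) ** X"
    by (simp add: matrix_uminus_mult)
  finally have "complex_mat X ** complex_mat M = (- transpose (complex_mat M)) ** complex_mat X"
    by (simp flip: complex_mat_mult complex_mat_transpose complex_mat_uminus)
  moreover have "\<not> eigenvalue (- transpose (complex_mat M)) l" if "eigenvalue (complex_mat M) l" for l
  proof
    assume "eigenvalue (- transpose (complex_mat M)) l"
    then have "eigenvalue (complex_mat M) (- l)"
      by (simp add: eigenvalue_uminus eigenvalue_transpose)
    then have "Re (- l) < 0" using M unfolding stable_mat_def by blast
    moreover have "Re l < 0" using M that unfolding stable_mat_def by blast
    ultimately show False by simp
  qed
  ultimately have "complex_mat X = 0" by (rule sylvester_homogeneous)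
  then show ?thesis by (simp add: complex_mat_eq_0)
qed

section \<open>Lyapunov equations\<close>

text \<open>
The equation is a square linear system in the entries of \<open>X\<close>, so injectivity suffices.
\<close>
lemma lyapunov_ex1:
  fixes M C :: "real^'n^'n"
  assumes M: "stable_mat M"
  shows "\<exists>!X. lyapunov_eq M C X"
proof -
  let ?L = "\<lambda>X. transpose M ** X + X ** M"
  have lin: "linear ?L"
    by (rule linearI) (simp_all add: matrix_add_ldistrib matrix_add_rdistrib
        matrix_scalar_ac scaleR_right_distrib flip: scalar_matrix_assoc)
  have inj: "inj ?L"
    unfolding linear_injective_0[OF lin] using lyapunov_homogeneous[OF M] by blast
  then have "surj ?L" using linear_injective_imp_surjective[OF lin inj] by simp
  then show ?thesis unfolding lyapunov_eq_def using inj unfolding surj_def inj_def by metis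
qed

lemma lyapunov_sol_eq: "stable_mat M \<Longrightarrow> lyapunov_eq M C (lyapunov_sol M C)"
  unfolding lyapunov_sol_def by (rule theI') (rule lyapunov_ex1)

lemma lyapunov_eq_sym:
  assumes "stable_mat M" "lyapunov_eq M C X" "transpose C = C"
  shows "transpose X = X"
proof -
  have "lyapunov_eq M C (transpose X)"
    unfolding lyapunov_eq_def
    using arg_cong[of _ _ transpose, OF assms(2)[unfolded lyapunov_eq_def]] assms(3)
    by (simp add: transpose_add matrix_transpose_mul add.commute)
  then show ?thesis using lyapunov_ex1[OF assms(1)] assms(2) by blast
qed

text \<open>
For an eigenvector \<open>v = a + i b\<close> this is the real part of the identity
\<open>(M v)\<^sup>* X v = cnj l (v\<^sup>* X v)\<close>.
\<close>
lemma eigenvector_parts_form: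
  fixes M X :: "real^'d^'d"
  assumes "transpose X = X" "M *v a = Re l *\<^sub>R a - Im l *\<^sub>R b"
    "M *v b = Im l *\<^sub>R a + Re l *\<^sub>R b"
  shows "(M *v a) \<bullet> (X *v a) + (M *v b) \<bullet> (X *v b) = Re l * (a \<bullet> (X *v a) + b \<bullet> (X *v b))"
  using inner_sym_matrix[OF assms(1), of a b]
  by (simp add: assms(2,3) inner_diff_left inner_add_left algebra_simps inner_commute)

lemma lyapunov_imp_stable:
  fixes M X :: "real^'n^'n"
  assumes X: "sym_psd X" and neg: "\<And>x. x \<noteq> 0 \<Longrightarrow> (M *v x) \<bullet> (X *v x) < 0"
  shows "stable_mat M"
proof (rule stable_matI)
  fix l a b
  assume ab: "a \<noteq> 0 \<or> b \<noteq> 0" and ev: "M *v a = Re l *\<^sub>R a - Im l *\<^sub>R b"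
    "M *v b = Im l *\<^sub>R a + Re l *\<^sub>R b"
  have neg': "(M *v x) \<bullet> (X *v x) \<le> 0" for x
    using neg[of x] by (cases "x = 0") auto
  have "(M *v a) \<bullet> (X *v a) + (M *v b) \<bullet> (X *v b) < 0"
    using ab neg[of a] neg[of b] neg'[of a] neg'[of b] by linarith
  also have "(M *v a) \<bullet> (X *v a) + (M *v b) \<bullet> (X *v b)
      = Re l * (a \<bullet> (X *v a) + b \<bullet> (X *v b))"
    using X by (intro eigenvector_parts_form ev) (simp add: sym_psd_def)
  finally have "Re l * (a \<bullet> (X *v a) + b \<bullet> (X *v b)) < 0" .
  moreover have "0 \<le> a \<bullet> (X *v a) + b \<bullet> (X *v b)" using X by (simp add: sym_psd_def)
  ultimately show "Re l < 0" by (meson mult_nonneg_nonneg not_less)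
qed

text \<open>
Let \<open>c\<close> be the minimum of the quotient of the forms of \<open>X\<close> and \<open>P\<close>, attained at \<open>v\<close>. Then
\<open>Y = X - c P\<close> is positive semidefinite with \<open>Y v = 0\<close>, so \<open>(M v) \<bullet> (Y v) = 0\<close>. If \<open>c\<close> were negative,
this number would be negative by the hypotheses on \<open>X\<close> and \<open>P\<close>.
\<close>
lemma lyapunov_sign_of_certificate:
  fixes M P X :: "real^'n^'n"
  assumes P: "sym_pd P" and neg: "\<And>x. x \<noteq> 0 \<Longrightarrow> (M *v x) \<bullet> (P *v x) < 0"
    and X: "transpose X = X" and nsd: "\<And>x. (M *v x) \<bullet> (X *v x) \<le> 0"
  shows "sym_psd X"
proof -
  define q where "q x = (x \<bullet> (X *v x)) / (x \<bullet> (P *v x))" for x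
  have Ppos: "x \<noteq> 0 \<Longrightarrow> 0 < x \<bullet> (P *v x)" for x using P by (simp add: sym_pd_def)
  have "continuous_on (sphere 0 1) q"
    unfolding q_def
  proof (intro continuous_intros matrix_vector_mult_linear_continuous_on)
    show "\<forall>x\<in>sphere 0 1. x \<bullet> (P *v x) \<noteq> 0"
      using Ppos by (metis less_irrefl norm_zero mem_sphere_0 zero_neq_one)
  qed
  moreover have "sphere 0 1 \<noteq> ({} :: (real^'n) set)" by simp
  ultimately obtain v where v: "v \<in> sphere 0 1" and min: "\<And>x. x \<in> sphere 0 1 \<Longrightarrow> q v \<le> q x"
    using continuous_attains_inf[OF compact_sphere] by blast
  have v0: "v \<noteq> 0" using v by auto
  have low: "q v * (x \<bullet> (P *v x)) \<le> x \<bullet> (X *v x)" for x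
  proof (cases "x = 0")
    case False
    let ?u = "x /\<^sub>R norm x"
    have "q v \<le> q ?u" by (rule min) (use False in simp)
    also have "q ?u = q x"
      using False by (simp add: q_def matrix_vector_mult_scaleR)
    finally show ?thesis using Ppos[OF False] by (simp add: q_def pos_le_divide_eq)
  qed simp
  have "0 \<le> q v"
  proof (rule ccontr)
    assume "\<not> 0 \<le> q v"
    then have s: "- q v > 0" by simp
    let ?Y = "X - q v *\<^sub>R P"
    have Ymult: "?Y *v x = X *v x - q v *\<^sub>R (P *v x)" for x
      by (simp add: matrix_vector_mult_diff_rdistrib scaleR_matrix_vector_assoc)
    have "sym_psd ?Y"
      using low X P
      by (simp add: sym_psd_def sym_pd_def Ymult inner_diff_right transpose_diff transpose_scalar)
    moreover have "v \<bullet> (?Y *v v) = 0"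
      using Ppos[OF v0] by (simp only: Ymult inner_diff_right inner_scaleR_right) (simp add: q_def)
    ultimately have "?Y *v v = 0" by (rule sym_psd_kernel)
    then have "(M *v v) \<bullet> (X *v v) + (- q v) * ((M *v v) \<bullet> (P *v v)) = 0"
      by (simp add: Ymult)
    moreover have "(- q v) * ((M *v v) \<bullet> (P *v v)) < 0"
      using s neg[OF v0] by (rule mult_pos_neg)
    ultimately show False using nsd[of v] by linarith
  qed
  then have "0 \<le> x \<bullet> (X *v x)" for x
  proof (cases "x = 0")
    case False
    have "0 \<le> q v * (x \<bullet> (P *v x))"
      using \<open>0 \<le> q v\<close> Ppos[OF False] by (intro mult_nonneg_nonneg) simp_all
    then show ?thesis using low[of x] by linarith
  qed simp
  then show ?thesis using X by (simp add: sym_psd_def)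
qed

lemma matrix_vector_bound:
  fixes M :: "real^'n^'m"
  obtains K where "0 \<le> K" "\<And>x. norm (M *v x) \<le> K * norm x"
  using onorm_pos_le[OF matrix_vector_mul_bounded_linear[of M]]
    onorm[OF matrix_vector_mul_bounded_linear[of M]] that by blast

lemma inner_matrix_bound:
  fixes M X :: "real^'n^'n"
  obtains K where "0 < K" "\<And>x. (M *v x) \<bullet> (X *v x) \<le> K * (x \<bullet> x)"
proof -
  obtain K where K: "0 \<le> K" "\<And>x. norm (M *v x) \<le> K * norm x" using matrix_vector_bound[of M] by blast
  obtain J where J: "0 \<le> J" "\<And>x. norm (X *v x) \<le> J * norm x" using matrix_vector_bound[of X] by blast
  show ?thesis
  proof
    show "0 < K * J + 1" using K(1) J(1) by (simp add: add_nonneg_pos)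
    fix x
    have "(M *v x) \<bullet> (X *v x) \<le> norm (M *v x) * norm (X *v x)" by (rule norm_cauchy_schwarz)
    also have "\<dots> \<le> (K * norm x) * (J * norm x)"
      by (rule mult_mono) (use K J in auto)
    also have "\<dots> = K * J * (x \<bullet> x)" by (simp add: norm_eq_sqrt_inner)
    also have "\<dots> \<le> (K * J + 1) * (x \<bullet> x)" by (rule mult_right_mono) auto
    finally show "(M *v x) \<bullet> (X *v x) \<le> (K * J + 1) * (x \<bullet> x)" .
  qed
qed

lemma stable_mat_minus_scalar:
  fixes M :: "real^'n^'n"
  assumes M: "stable_mat M" and t: "0 \<le> t"
  shows "stable_mat (M - mat t)"
proof (rule stable_matI)
  fix l a b
  assume ab: "a \<noteq> 0 \<or> b \<noteq> 0" "(M - mat t) *v a = Re l *\<^sub>R a - Im l *\<^sub>R b"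
    "(M - mat t) *v b = Im l *\<^sub>R a + Re l *\<^sub>R b"
  have "M *v a = Re (l + of_real t) *\<^sub>R a - Im (l + of_real t) *\<^sub>R b"
    using ab(2) by (simp add: matrix_vector_mult_diff_rdistrib mat_vector_scaleR algebra_simps)
  moreover have "M *v b = Im (l + of_real t) *\<^sub>R a + Re (l + of_real t) *\<^sub>R b"
    using ab(3) by (simp add: matrix_vector_mult_diff_rdistrib mat_vector_scaleR algebra_simps)
  ultimately have "Re (l + of_real t) < 0" by (rule stable_matD[OF M ab(1)])
  then show "Re l < 0" using t by simp
qed

text \<open>
Say that \<open>t \<ge> 0\<close> is good if \<open>M - t I\<close> has a certificate \<open>P\<close> as required. Large \<open>t\<close> are good with
\<open>P = I\<close>. Let \<open>t\<close> be the infimum of the good numbers. The matrix \<open>M - t I\<close> is still stable, so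
\<open>(M - t I)\<^sup>T P + P (M - t I) = - I\<close> has a solution. It is positive semidefinite by comparison with a
certificate for a slightly larger shift, and definite because its kernel is trivial. So \<open>t\<close> is good, and as
the same \<open>P\<close> serves slightly smaller shifts, \<open>t\<close> must be 0.
\<close>
lemma lyapunov_certificate:
  fixes M :: "real^'n^'n"
  assumes M: "stable_mat M"
  obtains P where "sym_pd P" "\<And>x. x \<noteq> 0 \<Longrightarrow> (M *v x) \<bullet> (P *v x) < 0"
proof -
  define good where "good t P \<longleftrightarrow> sym_pd P \<and>
      (\<forall>x. x \<noteq> 0 \<longrightarrow> (M *v x) \<bullet> (P *v x) < t * (x \<bullet> (P *v x)))" for t P
  define G where "G = {t. 0 \<le> t \<and> (\<exists>P. good t P)}"
  have up: "good u P" if "good t P" "t \<le> u" for t u P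
    unfolding good_def
  proof (intro conjI allI impI)
    show "sym_pd P" using that(1) by (simp add: good_def)
    fix x :: "real^'n" assume x: "x \<noteq> 0"
    have "0 < x \<bullet> (P *v x)" using that(1) x by (simp add: good_def sym_pd_def)
    then have "t * (x \<bullet> (P *v x)) \<le> u * (x \<bullet> (P *v x))" using that(2) by (simp add: mult_right_mono)
    then show "(M *v x) \<bullet> (P *v x) < u * (x \<bullet> (P *v x))"
      using that(1) x unfolding good_def by fastforce
  qed
  have ne: "G \<noteq> {}"
  proof -
    obtain K where K: "0 < K" "\<And>x. (M *v x) \<bullet> (mat 1 *v x) \<le> K * (x \<bullet> x)"
      using inner_matrix_bound[of M "mat 1"] by blast
    have "good (K + 1) (mat 1)"
      unfolding good_def sym_pd_def
    proof (intro conjI allI impI)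
      fix x :: "real^'n" assume "x \<noteq> 0"
      then have "0 < x \<bullet> x" by simp
      then show "(M *v x) \<bullet> (mat 1 *v x) < (K + 1) * (x \<bullet> (mat 1 *v x))"
        using K(2)[of x] by (simp add: algebra_simps add_pos_nonneg del: inner_gt_zero_iff)
    qed auto
    then have "K + 1 \<in> G" using K(1) unfolding G_def by auto
    then show ?thesis by blast
  qed
  define t where "t = Inf G"
  have bdd: "bdd_below G" unfolding G_def by (rule bdd_belowI[of _ 0]) simp
  have t0: "0 \<le> t" unfolding t_def by (rule cInf_greatest[OF ne]) (simp add: G_def)
  have above: "\<exists>P. good u P" if tu: "t < u" for u
  proof -
    obtain g where "g \<in> G" "g < u" using cInf_lessD[OF ne, of u] tu unfolding t_def by blast
    then show ?thesis unfolding G_def using up[of g _ u] by auto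
  qed
  let ?N = "M - mat t"
  have Nmult: "?N *v x = M *v x - t *\<^sub>R x" for x by (simp add: matrix_vector_mult_diff_rdistrib mat_vector_scaleR)
  have N: "stable_mat ?N" using stable_mat_minus_scalar[OF M t0] .
  define P where "P = lyapunov_sol ?N (- mat 1)"
  have eq: "lyapunov_eq ?N (- mat 1) P" unfolding P_def by (rule lyapunov_sol_eq[OF N])
  have sym: "transpose P = P"
    by (rule lyapunov_eq_sym[OF N eq]) (simp add: transpose_uminus)
  have form: "2 * ((?N *v x) \<bullet> (P *v x)) = - (x \<bullet> x)" for x
    using lyapunov_form[OF sym, of x ?N] eq
    by (simp add: lyapunov_eq_def uminus_matrix_vector)
  have MP: "2 * ((M *v x) \<bullet> (P *v x)) = 2 * t * (x \<bullet> (P *v x)) - x \<bullet> x" for x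
    using form[of x] by (simp add: Nmult inner_diff_left)
  obtain K where K: "0 < K" "\<And>x. (mat 1 *v x) \<bullet> (- P *v x) \<le> K * (x \<bullet> x)"
    using inner_matrix_bound[of "mat 1" "- P"] by blast
  have lowP: "- (x \<bullet> (P *v x)) \<le> K * (x \<bullet> x)" for x using K(2)[of x] by (simp add: uminus_matrix_vector)
  have psd: "sym_psd P"
  proof -
    \<comment> \<open>close enough to \<open>t\<close> that the shift by \<open>u - t\<close>, which costs at most \<open>(u - t) K \<parallel>x\<parallel>\<^sup>2\<close>,
      is absorbed by the term \<open>- \<parallel>x\<parallel>\<^sup>2 / 2\<close> of the Lyapunov equation\<close>
    define u where "u = t + 1 / (2 * K)"
    have "t < u" using K(1) by (simp add: u_def)
    then obtain W where W: "good u W" using above by blast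
    show ?thesis
    proof (rule lyapunov_sign_of_certificate[of W "M - mat u"])
      show "sym_pd W" using W by (simp add: good_def)
      show "((M - mat u) *v x) \<bullet> (W *v x) < 0" if "x \<noteq> 0" for x
        using W that by (simp add: good_def matrix_vector_mult_diff_rdistrib mat_vector_scaleR inner_diff_left)
      show "transpose P = P" by (rule sym)
      show "((M - mat u) *v x) \<bullet> (P *v x) \<le> 0" for x
      proof -
        have "(1 / (2 * K)) * (- (x \<bullet> (P *v x))) \<le> (1 / (2 * K)) * (K * (x \<bullet> x))"
          using lowP[of x] K(1) by (intro mult_left_mono) auto
        also have "\<dots> = (x \<bullet> x) / 2" using K(1) by simp
        finally show ?thesis
          using MP[of x] by (simp add: matrix_vector_mult_diff_rdistrib mat_vector_scaleR inner_diff_left u_def algebra_simps)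
      qed
    qed
  qed
  have pd: "sym_pd P"
    unfolding sym_pd_def
  proof (intro conjI allI impI)
    fix x :: "real^'n" assume x: "x \<noteq> 0"
    have "x \<bullet> (P *v x) \<noteq> 0"
    proof
      assume "x \<bullet> (P *v x) = 0"
      then have "P *v x = 0" by (rule sym_psd_kernel[OF psd])
      then show False using form[of x] x by simp
    qed
    then show "0 < x \<bullet> (P *v x)" using psd by (simp add: sym_psd_def less_le)
  qed (rule sym)
  have "t = 0"
  proof (rule ccontr)
    assume "t \<noteq> 0"
    then have tpos: "0 < t" using t0 by simp
    obtain J where J: "0 < J" "\<And>x. (mat 1 *v x) \<bullet> (P *v x) \<le> J * (x \<bullet> x)"
      using inner_matrix_bound[of "mat 1" P] by blast
    \<comment> \<open>lowering the shift by \<open>d\<close> costs at most \<open>d J \<parallel>x\<parallel>\<^sup>2\<close>, which must stay strictly below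
      \<open>\<parallel>x\<parallel>\<^sup>2 / 2\<close>, and \<open>d \<le> t\<close> keeps the shift nonnegative\<close>
    define d where "d = min t (1 / (4 * J))"
    have d: "0 < d" "d \<le> t" "d \<le> 1 / (4 * J)" using tpos J(1) by (simp_all add: d_def)
    have "good (t - d) P"
      unfolding good_def
    proof (intro conjI allI impI)
      fix x :: "real^'n" assume x: "x \<noteq> 0"
      have "d * (x \<bullet> (P *v x)) \<le> (1 / (4 * J)) * (J * (x \<bullet> x))"
        using d J pd x by (intro mult_mono) (auto simp: sym_pd_def less_imp_le)
      also have "\<dots> = (x \<bullet> x) / 4" using J(1) by simp
      finally have "d * (x \<bullet> (P *v x)) \<le> (x \<bullet> x) / 4" .
      moreover have "0 < x \<bullet> x" using x by simp
      ultimately show "(M *v x) \<bullet> (P *v x) < (t - d) * (x \<bullet> (P *v x))"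
        using MP[of x] left_diff_distrib[of t d "x \<bullet> (P *v x)"] by linarith
    qed (rule pd)
    then have "t - d \<in> G" using d(2) by (auto simp: G_def)
    then have "t \<le> t - d" unfolding t_def by (rule cInf_lower[OF _ bdd])
    then show False using d(1) by simp
  qed
  then have "(M *v x) \<bullet> (P *v x) < 0" if "x \<noteq> 0" for x
  proof -
    have "0 < x \<bullet> x" using \<open>x \<noteq> 0\<close> by simp
    then show ?thesis using MP[of x] unfolding \<open>t = 0\<close> by linarith
  qed
  then show ?thesis using that pd by blast
qed

lemma lyapunov_sign:
  fixes M X :: "real^'n^'n"
  assumes "stable_mat M" "transpose X = X" "\<And>x. (M *v x) \<bullet> (X *v x) \<le> 0"
  shows "sym_psd X"
  using lyapunov_certificate[OF assms(1)] lyapunov_sign_of_certificate[OF _ _ assms(2,3)] by blast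

section \<open>The Newton--Kleinman iteration\<close>

lemma sym_pd_invertible:
  fixes R :: "real^'m^'m"
  assumes "sym_pd R"
  shows "invertible R"
proof -
  have "x = 0" if "R *v x = 0" for x
    using assms that unfolding sym_pd_def by force
  then show ?thesis unfolding invertible_left_inverse matrix_left_invertible_ker by blast
qed

lemma sym_pd_matrix_inv:
  assumes "sym_pd R"
  shows "R ** matrix_inv R = mat 1" "matrix_inv R ** R = mat 1"
    "transpose (matrix_inv R) = matrix_inv R"
proof -
  show 1: "R ** matrix_inv R = mat 1" and 2: "matrix_inv R ** R = mat 1"
    using someI_ex[OF sym_pd_invertible[OF assms, unfolded invertible_def]]
    unfolding matrix_inv_def by blast+
  have "transpose (matrix_inv R) ** R = mat 1"
    using arg_cong[OF 1, of transpose] assms by (simp add: matrix_transpose_mul sym_pd_def)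
  then show "transpose (matrix_inv R) = matrix_inv R"
    using 1 by (metis matrix_mul_assoc matrix_mul_lid matrix_mul_rid)
qed

lemma tendsto_matrix_mult:
  fixes f :: "'a \<Rightarrow> real^'n^'m" and g :: "'a \<Rightarrow> real^'p^'n"
  assumes "(f \<longlongrightarrow> a) F" "(g \<longlongrightarrow> b) F"
  shows "((\<lambda>x. f x ** g x) \<longlongrightarrow> a ** b) F"
  unfolding matrix_matrix_mult_def
  by (intro tendsto_vec_lambda tendsto_sum tendsto_mult tendsto_vec_nth assms)

lemma tendsto_transpose:
  assumes "(f \<longlongrightarrow> a) F"
  shows "((\<lambda>x. transpose (f x)) \<longlongrightarrow> transpose a) F"
  unfolding transpose_def by (intro tendsto_vec_lambda tendsto_vec_nth assms)

lemma matrix_entry_inner: "X $ i $ j = axis i 1 \<bullet> (X *v axis j 1)" for X :: "real^'n^'m"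
  by (simp add: inner_axis' matrix_vector_mult_basis column_def)

text \<open>
The quadratic forms decrease and are bounded below, hence converge pointwise; polarization recovers
the entries of the matrices from them.
\<close>
lemma psd_decreasing_converges:
  fixes S :: "nat \<Rightarrow> real^'n^'n"
  assumes psd: "\<And>k. sym_psd (S k)" and dec: "\<And>k. sym_psd (S k - S (Suc k))"
  obtains X where "S \<longlonglongrightarrow> X" "sym_psd X"
proof -
  define q where "q x k = x \<bullet> (S k *v x)" for x k
  have sym: "transpose (S k) = S k" for k using psd by (simp add: sym_psd_def)
  have "decseq (q x)" for x
    using dec unfolding decseq_Suc_iff q_def
    by (simp add: sym_psd_def matrix_vector_mult_diff_rdistrib inner_diff_right)
  moreover have "0 \<le> q x k" for x k using psd by (simp add: q_def sym_psd_def)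
  ultimately have "convergent (q x)" for x
    using Bseq_monoseq_convergent decseq_bounded decseq_imp_monoseq by metis
  then have q: "q x \<longlonglongrightarrow> lim (q x)" for x by (simp add: convergent_LIMSEQ_iff)
  define X where "X = (\<chi> i j. (lim (q (axis i 1 + axis j 1)) - lim (q (axis i 1)) - lim (q (axis j 1))) / 2)"
  have "S k $ i $ j = (q (axis i 1 + axis j 1) k - q (axis i 1) k - q (axis j 1) k) / 2" for k i j
    using inner_sym_matrix[OF sym, of "axis i 1" k "axis j 1"]
    by (simp add: matrix_entry_inner q_def matrix_vector_right_distrib inner_add_left inner_add_right
        inner_commute)
  moreover have "(\<lambda>k. (q (axis i 1 + axis j 1) k - q (axis i 1) k - q (axis j 1) k) / 2)
      \<longlonglongrightarrow> X $ i $ j" for i j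
    unfolding X_def vec_lambda_beta by (intro tendsto_intros q) simp
  ultimately have "(\<lambda>k. S k $ i $ j) \<longlonglongrightarrow> X $ i $ j" for i j by presburger
  then have lim: "S \<longlonglongrightarrow> X" by (intro vec_tendstoI)
  have "(\<lambda>k. transpose (S k)) \<longlonglongrightarrow> transpose X" by (rule tendsto_transpose[OF lim])
  then have "transpose X = X" using lim by (simp add: sym LIMSEQ_unique)
  moreover have "0 \<le> x \<bullet> (X *v x)" for x
  proof (rule tendsto_lowerbound)
    show "(\<lambda>k. x \<bullet> (S k *v x)) \<longlonglongrightarrow> x \<bullet> (X *v x)"
      unfolding matrix_vector_mult_def
      by (intro tendsto_inner tendsto_const tendsto_vec_lambda tendsto_sum tendsto_mult tendsto_vec_nth lim)
    show "\<forall>\<^sub>F k in sequentially. 0 \<le> x \<bullet> (S k *v x)" using psd by (simp add: sym_psd_def)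
  qed simp
  ultimately show ?thesis using that lim by (simp add: sym_psd_def)
qed

locale riccati_data =
  fixes B :: "real^'m^'d" and Q :: "real^'d^'d" and R :: "real^'m^'m" and F :: "real^'d^'d"
  assumes Q_psd: "sym_psd Q" and R_pd: "sym_pd R"
    and F_eq: "F = B ** matrix_inv R ** transpose B"
begin

text \<open>
The feedback gain that is optimal for the value matrix \<open>X\<close>.
\<close>
definition gain :: "real^'d^'d \<Rightarrow> real^'d^'m" where
  "gain X = matrix_inv R ** transpose B ** X"

lemma B_gain: "B ** gain X = F ** X"
  by (simp add: gain_def F_eq matrix_mul_assoc)

lemma R_gain: "R *v (gain X *v x) = transpose B *v (X *v x)"
  by (simp add: gain_def matrix_vector_mul_assoc matrix_mul_assoc sym_pd_matrix_inv[OF R_pd])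

lemma R_gain_form: "(gain X *v x) \<bullet> (R *v (gain X *v x)) = (F *v (X *v x)) \<bullet> (X *v x)"
proof -
  have "(gain X *v x) \<bullet> (R *v (gain X *v x)) = (B *v (gain X *v x)) \<bullet> (X *v x)"
    by (simp add: R_gain inner_transpose)
  then show ?thesis by (simp add: matrix_vector_mul_assoc B_gain)
qed

lemma F_sym: "transpose F = F"
  by (simp add: F_eq matrix_transpose_mul matrix_mul_assoc sym_pd_matrix_inv[OF R_pd])

lemma R_nonneg: "0 \<le> k \<bullet> (R *v k)"
  using R_pd by (cases "k = 0") (auto simp: sym_pd_def less_imp_le)

lemma R_definite: "k \<bullet> (R *v k) = 0 \<Longrightarrow> k = 0"
  using R_pd by (metis less_irrefl sym_pd_def)

lemma F_nonneg: "0 \<le> (F *v x) \<bullet> x"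
  using R_gain_form[of "mat 1" x] R_nonneg[of "gain (mat 1) *v x"] by simp

lemma Q_nonneg: "0 \<le> x \<bullet> (Q *v x)"
  using Q_psd by (simp add: sym_psd_def)

lemma gain_cost:
  assumes "transpose S = S"
  shows "transpose (gain S) ** R ** gain S = S ** F ** S"
proof -
  have "transpose (gain S) ** R ** gain S
      = S ** B ** (matrix_inv R ** R) ** matrix_inv R ** transpose B ** S"
    by (simp only: gain_def matrix_transpose_mul transpose_transpose sym_pd_matrix_inv(3)[OF R_pd]
        assms matrix_mul_assoc)
  then show ?thesis by (simp add: sym_pd_matrix_inv[OF R_pd] F_eq matrix_mul_assoc)
qed

text \<open>
For stable \<open>A - B K\<close> the form of \<open>X\<close> is the quadratic cost of the feedback \<open>u = - K x\<close>.
Allowing an arbitrary gain \<open>K\<close> covers both the Newton--Kleinman step, where \<open>K = gain S\<close>, and the gain that stabilizability provides,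
which need not be of this form.
\<close>
definition cost_eq :: "real^'d^'d \<Rightarrow> real^'d^'m \<Rightarrow> real^'d^'d \<Rightarrow> bool" where
  "cost_eq A K X \<longleftrightarrow> lyapunov_eq (A - B ** K) (- (transpose K ** R ** K) - Q) X"

lemma newton_kleinman_step_eq:
  assumes "transpose S = S"
  shows "lyapunov_eq (A - F ** S) (- (S ** F ** S) - Q) X \<longleftrightarrow> cost_eq A (gain S) X"
  using assms by (simp add: cost_eq_def gain_cost B_gain)

lemma cost_sym:
  assumes "stable_mat (A - B ** K)" "cost_eq A K X"
  shows "transpose X = X"
proof (rule lyapunov_eq_sym[OF assms[unfolded cost_eq_def]])
  show "transpose (- (transpose K ** R ** K) - Q) = - (transpose K ** R ** K) - Q"
    using Q_psd R_pd
    by (simp add: transpose_diff transpose_uminus matrix_transpose_mul matrix_mul_assoc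
        sym_psd_def sym_pd_def)
qed

lemma cost_form:
  assumes sym: "transpose X = X" and X: "cost_eq A K X"
  shows "2 * (((A - B ** K) *v x) \<bullet> (X *v x)) = - ((K *v x) \<bullet> (R *v (K *v x))) - x \<bullet> (Q *v x)"
proof -
  have "2 * (((A - B ** K) *v x) \<bullet> (X *v x)) = x \<bullet> ((- (transpose K ** R ** K) - Q) *v x)"
    using X by (simp add: cost_eq_def lyapunov_eq_def flip: lyapunov_form[OF sym])
  also have "\<dots> = - ((K *v x) \<bullet> (R *v (K *v x))) - x \<bullet> (Q *v x)"
    by (simp add: matrix_vector_mult_diff_rdistrib uminus_matrix_vector inner_diff_right
        inner_transpose flip: matrix_vector_mul_assoc)
  finally show ?thesis .
qed

text \<open>
Completing the square in the gain: along the closed loop of \<open>gain X\<close> the Lyapunov function \<open>X\<close>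
decreases at the running cost of \<open>gain X\<close> plus the form of \<open>R\<close> at the difference of the gains.
\<close>
lemma policy_improvement:
  assumes sym: "transpose X = X" and X: "cost_eq A K X"
  shows "2 * (((A - F ** X) *v x) \<bullet> (X *v x))
    = - ((K *v x - gain X *v x) \<bullet> (R *v (K *v x - gain X *v x)))
      - (F *v (X *v x)) \<bullet> (X *v x) - x \<bullet> (Q *v x)"
proof -
  let ?k = "K *v x" and ?g = "gain X *v x" and ?p = "X *v x"
  have "(A - F ** X) *v x = (A - B ** K) *v x + B *v (?k - ?g)"
    by (simp add: matrix_vector_mult_diff_rdistrib matrix_vector_mult_diff_distrib
        matrix_vector_mul_assoc B_gain)
  then have "2 * (((A - F ** X) *v x) \<bullet> ?p)
      = - (?k \<bullet> (R *v ?k)) - x \<bullet> (Q *v x) + 2 * ((?k - ?g) \<bullet> (R *v ?g))"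
    using cost_form[OF assms, of x] by (simp add: inner_add_left R_gain inner_transpose)
  also have "\<dots> = - ((?k - ?g) \<bullet> (R *v (?k - ?g))) - ?g \<bullet> (R *v ?g) - x \<bullet> (Q *v x)"
    using R_pd inner_sym_matrix[of R ?k ?g]
    by (simp add: sym_pd_def matrix_vector_mult_diff_distrib inner_diff_left inner_diff_right
        inner_commute[of "R *v ?k"] algebra_simps)
  finally show ?thesis by (simp only: R_gain_form)
qed

lemma cost_psd:
  assumes K: "stable_mat (A - B ** K)" and X: "cost_eq A K X"
  shows "sym_psd X"
proof (rule lyapunov_sign[OF K cost_sym[OF K X]])
  show "((A - B ** K) *v x) \<bullet> (X *v x) \<le> 0" for x
    using cost_form[OF cost_sym[OF K X] X, of x] R_nonneg[of "K *v x"] Q_nonneg[of x] by linarith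
qed

text \<open>
Take an eigenvector of the new closed loop for an eigenvalue that is not in the open left half plane.
On it every nonpositive term of \<open>policy_improvement\<close> must vanish, so the two gains agree there
and it is an eigenvector of \<open>A - B K\<close> as well, which is stable.
\<close>
lemma policy_improvement_stable:
  assumes K: "stable_mat (A - B ** K)" and X: "cost_eq A K X"
  shows "stable_mat (A - F ** X)"
proof (rule stable_matI)
  fix l a b
  assume ab: "a \<noteq> 0 \<or> b \<noteq> 0" and ev: "(A - F ** X) *v a = Re l *\<^sub>R a - Im l *\<^sub>R b"
    "(A - F ** X) *v b = Im l *\<^sub>R a + Re l *\<^sub>R b"
  have sym: "transpose X = X" by (rule cost_sym[OF K X])
  have pos: "0 \<le> a \<bullet> (X *v a) + b \<bullet> (X *v b)"
    using cost_psd[OF K X] by (simp add: sym_psd_def)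
  show "Re l < 0"
  proof (rule ccontr)
    assume "\<not> Re l < 0"
    then have nn: "0 \<le> ((A - F ** X) *v a) \<bullet> (X *v a) + ((A - F ** X) *v b) \<bullet> (X *v b)"
      using pos by (simp add: eigenvector_parts_form[OF sym ev])
    let ?e = "\<lambda>x. K *v x - gain X *v x"
    have "0 \<le> ?e x \<bullet> (R *v ?e x)" "0 \<le> (F *v (X *v x)) \<bullet> (X *v x)" "0 \<le> x \<bullet> (Q *v x)" for x
      by (rule R_nonneg F_nonneg Q_nonneg)+
    from this[of a] this[of b] have "?e a \<bullet> (R *v ?e a) = 0 \<and> ?e b \<bullet> (R *v ?e b) = 0"
      using nn policy_improvement[OF sym X, of a] policy_improvement[OF sym X, of b] by linarith
    then have "?e a = 0" "?e b = 0"
      using R_definite by blast+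
    then have "(A - B ** K) *v a = (A - F ** X) *v a" "(A - B ** K) *v b = (A - F ** X) *v b"
      by (simp_all add: matrix_vector_mult_diff_rdistrib flip: matrix_vector_mul_assoc B_gain)
    then have "Re l < 0" using stable_matD[OF K ab] ev by simp
    then show False using \<open>\<not> Re l < 0\<close> by simp
  qed
qed

text \<open>
Solutions of the Riccati equation are the fixed points of the Newton--Kleinman step.
\<close>
lemma riccati_iff_cost:
  assumes X: "transpose X = X"
  shows "riccati_eq A F Q X \<longleftrightarrow> cost_eq A (gain X) X"
proof -
  have "transpose (A - F ** X) ** X + X ** (A - F ** X) - (- (X ** F ** X) - Q)
      = transpose A ** X + X ** A - X ** F ** X + Q"
    by (simp add: transpose_diff matrix_transpose_mul F_sym X matrix_diff_ldistrib
        matrix_diff_rdistrib matrix_mul_assoc)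
  then show ?thesis
    unfolding newton_kleinman_step_eq[OF X, symmetric] riccati_eq_def lyapunov_eq_def
    by (metis eq_iff_diff_eq_0)
qed

lemma gain_stable_iff: "stable_mat (A - B ** gain S) \<longleftrightarrow> stable_mat (A - F ** S)"
  by (simp add: B_gain)

context
  fixes A P0 :: "real^'d^'d"
  assumes P0_sym: "transpose P0 = P0" and P0_stab: "stable_mat (A - F ** P0)"
begin

abbreviation "S \<equiv> newton_kleinman A F Q P0"

lemma newton_kleinman_invariant: "transpose (S k) = S k \<and> stable_mat (A - F ** S k)"
proof (induction k)
  case (Suc k)
  have "lyapunov_eq (A - F ** S k) (- (S k ** F ** S k) - Q) (S (Suc k))"
    using Suc by (simp add: Let_def lyapunov_sol_eq)
  then have "cost_eq A (gain (S k)) (S (Suc k))"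
    using Suc by (simp only: newton_kleinman_step_eq)
  then show ?case
    using Suc cost_sym policy_improvement_stable gain_stable_iff by blast
qed (simp add: P0_sym P0_stab)

lemma newton_kleinman_cost: "cost_eq A (gain (S k)) (S (Suc k))"
proof -
  have "lyapunov_eq (A - F ** S k) (- (S k ** F ** S k) - Q) (S (Suc k))"
    using newton_kleinman_invariant[of k] by (simp add: Let_def lyapunov_sol_eq)
  then show ?thesis using newton_kleinman_invariant by (simp only: newton_kleinman_step_eq)
qed

lemma newton_kleinman_psd: "sym_psd (S (Suc k))"
  using cost_psd newton_kleinman_cost newton_kleinman_invariant gain_stable_iff by blast

text \<open>
Both iterates are compared along the closed loop of the earlier one: there the later one has the
derivative given by \<open>cost_form\<close>, and the earlier one at most that, by \<open>policy_improvement\<close>. The initial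
guess is excluded because it need not be the cost of any gain.
\<close>
lemma newton_kleinman_decreasing: "sym_psd (S (Suc k) - S (Suc (Suc k)))"
proof (rule lyapunov_sign)
  let ?X = "S (Suc k)" and ?Y = "S (Suc (Suc k))"
  have sX: "transpose ?X = ?X" and sY: "transpose ?Y = ?Y"
    using newton_kleinman_invariant by blast+
  show "stable_mat (A - F ** ?X)" using newton_kleinman_invariant by blast
  show "transpose (?X - ?Y) = ?X - ?Y" by (simp only: transpose_diff sX sY)
  show "((A - F ** ?X) *v x) \<bullet> ((?X - ?Y) *v x) \<le> 0" for x
  proof -
    have "2 * (((A - F ** ?X) *v x) \<bullet> (?Y *v x)) = - (F *v (?X *v x)) \<bullet> (?X *v x) - x \<bullet> (Q *v x)"
      using cost_form[OF sY newton_kleinman_cost, of x] by (simp only: B_gain R_gain_form) simp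
    moreover note policy_improvement[OF sX newton_kleinman_cost, of x]
    moreover note R_nonneg[of "gain (S k) *v x - gain ?X *v x"]
    moreover have "((A - F ** ?X) *v x) \<bullet> ((?X - ?Y) *v x)
        = ((A - F ** ?X) *v x) \<bullet> (?X *v x) - ((A - F ** ?X) *v x) \<bullet> (?Y *v x)"
      by (simp only: matrix_vector_mult_diff_rdistrib inner_diff_right)
    ultimately show ?thesis by simp
  qed
qed


lemma newton_kleinman_converges:
  obtains X where "S \<longlonglongrightarrow> X" "sym_psd X" "riccati_eq A F Q X"
proof -
  obtain X where lim: "(\<lambda>k. S (Suc k)) \<longlonglongrightarrow> X" and X: "sym_psd X"
    using psd_decreasing_converges[of "\<lambda>k. S (Suc k)"] newton_kleinman_psd newton_kleinman_decreasing by blast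
  then have lim0: "S \<longlonglongrightarrow> X" by (simp only: filterlim_sequentially_Suc)
  have sym: "transpose X = X" using X by (simp add: sym_psd_def)
  have eq: "transpose (A - F ** S k) ** S (Suc k) + S (Suc k) ** (A - F ** S k)
      = - (S k ** F ** S k) - Q" for k
    using newton_kleinman_cost[of k] newton_kleinman_invariant[of k]
    unfolding lyapunov_eq_def[symmetric] by (simp only: newton_kleinman_step_eq)
  have "(\<lambda>k. transpose (A - F ** S k) ** S (Suc k) + S (Suc k) ** (A - F ** S k))
      \<longlonglongrightarrow> transpose (A - F ** X) ** X + X ** (A - F ** X)"
    by (intro tendsto_intros tendsto_matrix_mult tendsto_transpose lim lim0)
  moreover have "(\<lambda>k. - (S k ** F ** S k) - Q) \<longlonglongrightarrow> - (X ** F ** X) - Q"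
    by (intro tendsto_intros tendsto_matrix_mult lim0)
  ultimately have "lyapunov_eq (A - F ** X) (- (X ** F ** X) - Q) X"
    unfolding eq lyapunov_eq_def by (rule LIMSEQ_unique)
  then have "riccati_eq A F Q X"
    by (simp only: riccati_iff_cost[OF sym] newton_kleinman_step_eq[OF sym])
  then show ?thesis using that lim0 X by blast
qed

end

text \<open>
One evaluation of the cost of an arbitrary stabilizing gain produces an admissible initial guess.
\<close>
lemma riccati_exists:
  assumes "stabilizable A B"
  obtains X where "sym_psd X" "riccati_eq A F Q X"
proof -
  obtain K where K: "stable_mat (A - B ** K)" using assms unfolding stabilizable_def by blast
  define P where "P = lyapunov_sol (A - B ** K) (- (transpose K ** R ** K) - Q)"
  have "cost_eq A K P" unfolding cost_eq_def P_def by (rule lyapunov_sol_eq[OF K])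
  then have "transpose P = P" "stable_mat (A - F ** P)"
    using cost_sym policy_improvement_stable K by blast+
  from newton_kleinman_converges[OF this] show ?thesis using that by blast
qed

end

section \<open>Square roots of positive semidefinite matrices\<close>

text \<open>
The equation \<open>S S = Q\<close> is the Riccati equation for \<open>A = 0\<close> and \<open>B = R = I\<close>, so the existence of a
root needs no spectral theorem.
\<close>
lemma psd_sqrt_exists:
  fixes Q :: "real^'d^'d"
  assumes "sym_psd Q"
  obtains S where "sym_psd S" "S ** S = Q"
proof -
  have pd: "sym_pd (mat 1 :: real^'d^'d)" by (simp add: sym_pd_def)
  have "matrix_inv (mat 1 :: real^'d^'d) = mat 1"
    using sym_pd_matrix_inv(1)[OF pd] by simp
  then interpret riccati_data "mat 1 :: real^'d^'d" Q "mat 1" "mat 1"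
    by unfold_locales (simp_all add: assms pd)
  have "stable_mat (0 - mat 1 ** (mat 1 :: real^'d^'d))"
    by (rule lyapunov_imp_stable[of "mat 1"])
       (simp_all add: sym_psd_def uminus_matrix_vector)
  then have "stabilizable 0 (mat 1 :: real^'d^'d)" unfolding stabilizable_def by blast
  then obtain S where "sym_psd S" "riccati_eq 0 (mat 1) Q S" by (rule riccati_exists)
  moreover from this(2) have "S ** S = Q" by (simp add: riccati_eq_def transpose_zero)
  ultimately show ?thesis using that by blast
qed

text \<open>
With \<open>D = S - T\<close> one has \<open>S D + D T = S\<^sup>2 - T\<^sup>2 = 0\<close>. Multiplying by \<open>D\<close> and taking traces gives
\<open>tr (D S D) + tr (D T D) = 0\<close>. Both matrices are positive semidefinite, so every diagonal entry vanishes;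
hence \<open>S D = T D = 0\<close> and \<open>D\<^sup>2 = 0\<close>.
\<close>
lemma psd_sqrt_unique:
  fixes S T :: "real^'d^'d"
  assumes S: "sym_psd S" and T: "sym_psd T" and eq: "S ** S = T ** T"
  shows "S = T"
proof -
  define D where "D = S - T"
  have sym: "transpose D = D" using S T by (simp add: D_def sym_psd_def transpose_diff)
  have "S ** D + D ** T = 0"
    by (simp add: D_def matrix_diff_ldistrib matrix_diff_rdistrib eq)
  then have "D ** (S ** D) + D ** (D ** T) = 0"
    by (metis matrix_add_ldistrib matrix_mul_rzero)
  then have "trace (D ** (S ** D)) + trace (D ** (D ** T)) = 0"
    by (simp add: trace_0[simplified] flip: trace_add)
  moreover have "trace (D ** (D ** T)) = trace (D ** (T ** D))"
    by (metis matrix_mul_assoc trace_mul_sym)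
  moreover have tr: "trace (D ** (X ** D)) = (\<Sum>i\<in>UNIV. (D *v axis i 1) \<bullet> (X *v (D *v axis i 1)))" for X
  proof -
    have "(D ** (X ** D)) $ i $ i = (D *v axis i 1) \<bullet> (X *v (D *v axis i 1))" for i
    proof -
      have "(D ** (X ** D)) $ i $ i = axis i 1 \<bullet> ((D ** (X ** D)) *v axis i 1)"
        by (simp add: inner_axis' matrix_vector_mult_basis column_def)
      also have "\<dots> = axis i 1 \<bullet> (D *v (X *v (D *v axis i 1)))"
        by (simp add: matrix_vector_mul_assoc matrix_mul_assoc)
      finally show ?thesis by (simp only: inner_sym_matrix[OF sym])
    qed
    then show ?thesis by (simp add: trace_def)
  qed
  ultimately have "(\<Sum>i\<in>UNIV. (D *v axis i 1) \<bullet> (S *v (D *v axis i 1))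
      + (D *v axis i 1) \<bullet> (T *v (D *v axis i 1))) = 0"
    by (simp add: sum.distrib)
  then have "\<forall>i\<in>UNIV. (D *v axis i 1) \<bullet> (S *v (D *v axis i 1))
      + (D *v axis i 1) \<bullet> (T *v (D *v axis i 1)) = 0"
    using S T by (subst (asm) sum_nonneg_eq_0_iff) (auto simp: sym_psd_def)
  then have "(D *v axis i 1) \<bullet> (S *v (D *v axis i 1)) = 0 \<and> (D *v axis i 1) \<bullet> (T *v (D *v axis i 1)) = 0" for i
    using S T by (simp add: sym_psd_def add_nonneg_eq_0_iff)
  then have "S *v (D *v axis i 1) = 0" "T *v (D *v axis i 1) = 0" for i
    using sym_psd_kernel[OF S] sym_psd_kernel[OF T] by blast+
  then have "D *v (D *v axis i 1) = 0" for i
    by (simp add: D_def matrix_vector_mult_diff_rdistrib)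
  then have "(D *v axis i 1) \<bullet> (D *v axis i 1) = 0" for i
    by (simp flip: inner_sym_matrix[OF sym])
  then have "column i D = 0" for i by (simp add: matrix_vector_mult_basis)
  then have "D = 0" by (simp add: column_def vec_eq_iff)
  then show ?thesis by (simp add: D_def)
qed

lemma psd_sqrt_props:
  assumes "sym_psd Q"
  shows "sym_psd (psd_sqrt Q)" "psd_sqrt Q ** psd_sqrt Q = Q"
proof -
  have "\<exists>!S. sym_psd S \<and> S ** S = Q"
    using psd_sqrt_exists[OF assms] psd_sqrt_unique by metis
  then have "sym_psd (psd_sqrt Q) \<and> psd_sqrt Q ** psd_sqrt Q = Q"
    unfolding psd_sqrt_def by (rule theI')
  then show "sym_psd (psd_sqrt Q)" "psd_sqrt Q ** psd_sqrt Q = Q" by auto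
qed

lemma psd_sqrt_kernel:
  assumes Q: "sym_psd Q" and x: "x \<bullet> (Q *v x) = 0"
  shows "psd_sqrt Q *v x = 0"
proof -
  have "transpose (psd_sqrt Q) = psd_sqrt Q" using psd_sqrt_props(1)[OF Q] by (simp add: sym_psd_def)
  then have "(psd_sqrt Q *v x) \<bullet> (psd_sqrt Q *v x) = x \<bullet> ((psd_sqrt Q ** psd_sqrt Q) *v x)"
    by (simp add: inner_sym_matrix flip: matrix_vector_mul_assoc)
  then show ?thesis using x by (simp add: psd_sqrt_props(2)[OF Q])
qed

section \<open>Uniqueness and stability of the Riccati solution\<close>

context riccati_data
begin

text \<open>
An eigenvector of \<open>A - F X\<close> for an eigenvalue with nonnegative real part is annihilated by
\<open>gain X\<close> and by the root of \<open>Q\<close>, hence it is an eigenvector of every \<open>A - G Q\<^sup>1\<^sup>/\<^sup>2\<close>. Detectability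
provides a \<open>G\<close> for which that matrix is stable.
\<close>
lemma riccati_stabilizing:
  assumes det: "detectable A (psd_sqrt Q)" and X: "sym_psd X" and ric: "riccati_eq A F Q X"
  shows "stable_mat (A - F ** X)"
proof (rule stable_matI)
  fix l a b
  assume ab: "a \<noteq> 0 \<or> b \<noteq> 0" and ev: "(A - F ** X) *v a = Re l *\<^sub>R a - Im l *\<^sub>R b"
    "(A - F ** X) *v b = Im l *\<^sub>R a + Re l *\<^sub>R b"
  have sym: "transpose X = X" using X by (simp add: sym_psd_def)
  have pos: "0 \<le> a \<bullet> (X *v a) + b \<bullet> (X *v b)" using X by (simp add: sym_psd_def)
  show "Re l < 0"
  proof (rule ccontr)
    assume neg: "\<not> Re l < 0"
    then have nn: "0 \<le> ((A - F ** X) *v a) \<bullet> (X *v a) + ((A - F ** X) *v b) \<bullet> (X *v b)"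
      using pos by (simp add: eigenvector_parts_form[OF sym ev])
    have "cost_eq A (gain X) X" using ric by (simp only: riccati_iff_cost[OF sym])
    note cost = cost_form[OF sym this, unfolded B_gain]
    have "0 \<le> (gain X *v x) \<bullet> (R *v (gain X *v x))" "0 \<le> x \<bullet> (Q *v x)" for x
      by (rule R_nonneg Q_nonneg)+
    from this[of a] this[of b]
    have "(gain X *v a) \<bullet> (R *v (gain X *v a)) = 0 \<and> (gain X *v b) \<bullet> (R *v (gain X *v b)) = 0
        \<and> a \<bullet> (Q *v a) = 0 \<and> b \<bullet> (Q *v b) = 0"
      using nn cost[of a] cost[of b] by linarith
    then have g: "gain X *v a = 0" "gain X *v b = 0"
      and s: "psd_sqrt Q *v a = 0" "psd_sqrt Q *v b = 0"
      using R_definite psd_sqrt_kernel[OF Q_psd] by blast+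
    obtain K where "stable_mat (transpose A - transpose (psd_sqrt Q) ** K)"
      using det unfolding detectable_def stabilizable_def by blast
    then have "stable_mat (transpose (transpose A - transpose (psd_sqrt Q) ** K))"
      by (simp only: stable_mat_transpose)
    then have st: "stable_mat (A - transpose K ** psd_sqrt Q)"
      by (simp add: transpose_diff matrix_transpose_mul)
    have "(A - transpose K ** psd_sqrt Q) *v a = (A - F ** X) *v a"
      "(A - transpose K ** psd_sqrt Q) *v b = (A - F ** X) *v b"
      using g s by (simp_all add: matrix_vector_mult_diff_rdistrib
          flip: matrix_vector_mul_assoc[of _ "psd_sqrt Q"] B_gain matrix_vector_mul_assoc[of B])
    then have "Re l < 0" using stable_matD[OF st ab] ev by simp
    then show False using neg by simp
  qed
qed

text \<open>
Along the closed loop of \<open>X\<close> the form of \<open>X - Y\<close> has derivative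
\<open>- (X - Y) F (X - Y) \<le> 0\<close>, so \<open>lyapunov_sign\<close> applies.
\<close>
lemma riccati_maximal:
  assumes X: "transpose X = X" "riccati_eq A F Q X" "stable_mat (A - F ** X)"
    and Y: "transpose Y = Y" "riccati_eq A F Q Y"
  shows "sym_psd (X - Y)"
proof (rule lyapunov_sign[OF X(3)])
  show "transpose (X - Y) = X - Y" by (simp add: transpose_diff X Y)
  have cost: "2 * (((A - F ** Z) *v x) \<bullet> (Z *v x)) = - ((F *v (Z *v x)) \<bullet> (Z *v x)) - x \<bullet> (Q *v x)"
    if Z: "transpose Z = Z" "riccati_eq A F Q Z" for Z x
  proof -
    have "cost_eq A (gain Z) Z" using Z(2) by (simp only: riccati_iff_cost[OF Z(1)])
    from cost_form[OF Z(1) this, of x] show ?thesis by (simp only: B_gain R_gain_form)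
  qed
  show "((A - F ** X) *v x) \<bullet> ((X - Y) *v x) \<le> 0" for x
  proof -
    let ?p = "X *v x" and ?q = "Y *v x"
    have "(A - F ** X) *v x = (A - F ** Y) *v x + F *v (?q - ?p)"
      by (simp add: matrix_vector_mult_diff_rdistrib matrix_vector_mult_diff_distrib
          matrix_vector_mul_assoc)
    then have "2 * (((A - F ** X) *v x) \<bullet> ?q)
        = - ((F *v ?q) \<bullet> ?q) - x \<bullet> (Q *v x) + 2 * ((F *v (?q - ?p)) \<bullet> ?q)"
      using cost[OF Y] by (simp add: inner_add_left)
    moreover have "(F *v (?p - ?q)) \<bullet> (?p - ?q)
        = (F *v ?p) \<bullet> ?p + (F *v ?q) \<bullet> ?q - 2 * ((F *v ?p) \<bullet> ?q)"
      using inner_sym_matrix[OF F_sym, of ?p ?q]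
      by (simp add: matrix_vector_mult_diff_distrib inner_diff_left inner_diff_right inner_commute)
    moreover note F_nonneg[of "?p - ?q"] cost[OF X(1,2), of x]
    ultimately show ?thesis
      by (simp add: matrix_vector_mult_diff_rdistrib[of X] inner_diff_right
          matrix_vector_mult_diff_distrib[of F] inner_diff_left)
  qed
qed

lemma riccati_ex1:
  assumes "stabilizable A B" "detectable A (psd_sqrt Q)"
  shows "\<exists>!X. sym_psd X \<and> riccati_eq A F Q X"
proof -
  obtain X where X: "sym_psd X" "riccati_eq A F Q X" using riccati_exists[OF assms(1)] .
  moreover have "Y = X" if Y: "sym_psd Y" "riccati_eq A F Q Y" for Y
  proof -
    have "sym_psd (X - Y)" "sym_psd (Y - X)"
      using riccati_maximal riccati_stabilizing[OF assms(2)] X Y by (auto simp: sym_psd_def)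
    then have "Y - X = 0"
      by (intro symmetric_matrix_eq_0)
         (auto simp: sym_psd_def matrix_vector_mult_diff_rdistrib inner_diff_right intro: antisym)
    then show ?thesis by simp
  qed
  ultimately show ?thesis by blast
qed

lemma riccati_sol_props:
  assumes "stabilizable A B" "detectable A (psd_sqrt Q)"
  shows "sym_psd (riccati_sol A F Q)" "riccati_eq A F Q (riccati_sol A F Q)"
    "stable_mat (A - F ** riccati_sol A F Q)"
proof -
  have *: "sym_psd (riccati_sol A F Q) \<and> riccati_eq A F Q (riccati_sol A F Q)"
    unfolding riccati_sol_def by (rule theI') (rule riccati_ex1[OF assms])
  then show "sym_psd (riccati_sol A F Q)" "riccati_eq A F Q (riccati_sol A F Q)" by auto
  with riccati_stabilizing[OF assms(2)] show "stable_mat (A - F ** riccati_sol A F Q)" by blast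
qed

lemma newton_kleinman_tendsto:
  assumes "stabilizable A B" "detectable A (psd_sqrt Q)"
    and "transpose P0 = P0" "stable_mat (A - F ** P0)"
  shows "newton_kleinman A F Q P0 \<longlonglongrightarrow> riccati_sol A F Q"
proof -
  obtain X where X: "newton_kleinman A F Q P0 \<longlonglongrightarrow> X" "sym_psd X" "riccati_eq A F Q X"
    using newton_kleinman_converges[OF assms(3,4)] .
  have "X = riccati_sol A F Q"
    using riccati_ex1[OF assms(1,2)] riccati_sol_props[OF assms(1,2)] X(2,3) by blast
  then show ?thesis using X(1) by simp
qed

end

section \<open>Perturbation of stable matrices\<close>

lemma opnorm_bound: "norm (M *v x) \<le> opnorm M * norm x"
  unfolding opnorm_def by (rule onorm[OF matrix_vector_mul_bounded_linear])

lemma opnorm_nonneg: "0 \<le> opnorm M"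
  unfolding opnorm_def by (rule onorm_pos_le[OF matrix_vector_mul_bounded_linear])

lemma opnorm_pos: "M \<noteq> 0 \<Longrightarrow> 0 < opnorm M"
  unfolding opnorm_def onorm_pos_lt[OF matrix_vector_mul_bounded_linear] by (metis matrix_eq matrix_vector_mult_0)

lemma lyapunov_identity:
  fixes M :: "real^'d^'d"
  assumes M: "stable_mat M"
  defines "H \<equiv> lyapunov_sol M (- mat 1)"
  shows "sym_psd H" "2 * ((M *v x) \<bullet> (H *v x)) = - (x \<bullet> x)" "0 < opnorm H"
proof -
  have eq: "lyapunov_eq M (- mat 1) H" unfolding H_def by (rule lyapunov_sol_eq[OF M])
  have sym: "transpose H = H" by (rule lyapunov_eq_sym[OF M eq]) (simp add: transpose_uminus)
  show form: "2 * ((M *v x) \<bullet> (H *v x)) = - (x \<bullet> x)" for x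
    using lyapunov_form[OF sym, of x M] eq by (simp add: lyapunov_eq_def uminus_matrix_vector)
  show "sym_psd H"
  proof (rule lyapunov_sign[OF M sym])
    show "(M *v x) \<bullet> (H *v x) \<le> 0" for x
      using form[of x] inner_ge_zero[of x] by linarith
  qed
  have "H \<noteq> 0"
  proof
    assume "H = 0"
    then have "axis i 1 \<bullet> (axis i 1 :: real^'d) = 0" for i using form[of "axis i 1"] by simp
    then show False by (simp add: inner_axis)
  qed
  then show "0 < opnorm H" by (rule opnorm_pos)
qed

text \<open>
The solution \<open>H\<close> of the Lyapunov equation for \<open>M\<close> is also a Lyapunov function for \<open>N\<close>.
\<close>
lemma stable_mat_perturb:
  fixes M N :: "real^'d^'d"
  assumes M: "stable_mat M" and small: "2 * opnorm (N - M) * opnorm (lyapunov_sol M (- mat 1)) < 1"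
  shows "stable_mat N"
proof (rule lyapunov_imp_stable)
  let ?H = "lyapunov_sol M (- mat 1)" and ?E = "N - M"
  show "sym_psd ?H" by (rule lyapunov_identity[OF M])
  fix x :: "real^'d" assume "x \<noteq> 0"
  then have xx: "0 < x \<bullet> x" by simp
  have "(?E *v x) \<bullet> (?H *v x) \<le> norm (?E *v x) * norm (?H *v x)" by (rule norm_cauchy_schwarz)
  also have "\<dots> \<le> (opnorm ?E * norm x) * (opnorm ?H * norm x)"
    by (intro mult_mono opnorm_bound mult_nonneg_nonneg opnorm_nonneg norm_ge_zero)
  also have "\<dots> = (opnorm ?E * opnorm ?H) * (x \<bullet> x)"
    by (simp add: dot_square_norm power2_eq_square)
  finally have "2 * ((?E *v x) \<bullet> (?H *v x)) \<le> (2 * opnorm ?E * opnorm ?H) * (x \<bullet> x)" by simp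
  also have "\<dots> < x \<bullet> x" using small xx by simp
  finally show "(N *v x) \<bullet> (?H *v x) < 0"
    using lyapunov_identity(2)[OF M, of x]
    by (simp add: matrix_vector_mult_diff_rdistrib inner_diff_left)
qed

section \<open>Divergence of trajectories\<close>

text \<open>
The logarithmic norm is a supremum over complex vectors, so it bounds the real quotients from above
once it is known to be finite; the operator norm bounds it.
\<close>
lemma inner_le_logm:
  fixes M :: "real^'d^'d"
  shows "(M *v z) \<bullet> z \<le> logm (complex_mat M) * (z \<bullet> z)"
proof (cases "z = 0")
  case False
  let ?C = "complex_mat M"
  let ?f = "\<lambda>x. Re (\<Sum>i\<in>UNIV. (?C *v x) $ i * cnj (x $ i)) / (norm x)\<^sup>2"
  have f: "?f x = ((?C *v x) \<bullet> x) / (norm x)\<^sup>2" for x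
    by (simp add: inner_vec_def inner_complex_def)
  have bl: "bounded_linear ((*v) ?C)" by simp
  have bdd: "bdd_above (?f ` (UNIV - {0}))"
  proof (rule bdd_aboveI2)
    fix x :: "complex^'d" assume "x \<in> UNIV - {0}"
    then have x: "norm x > 0" by simp
    have "(?C *v x) \<bullet> x \<le> norm (?C *v x) * norm x" by (rule norm_cauchy_schwarz)
    also have "\<dots> \<le> onorm ((*v) ?C) * norm x * norm x"
      using onorm[OF bl, of x] by (intro mult_right_mono) auto
    finally show "?f x \<le> onorm ((*v) ?C)"
      unfolding f using x by (simp add: divide_le_eq power2_eq_square mult.assoc)
  qed
  define x :: "complex^'d" where "x = (\<chi> i. complex_of_real (z $ i))"
  have re: "(\<chi> j. Re (x $ j)) = z" and im: "(\<chi> j. Im (x $ j)) = 0"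
    by (simp_all add: x_def vec_eq_iff)
  have "x \<noteq> 0" using False by (auto simp: x_def vec_eq_iff)
  have inner: "(?C *v x) \<bullet> x = (M *v z) \<bullet> z"
    by (simp add: inner_vec_def inner_complex_def Re_complex_mat_mult Im_complex_mat_mult re im)
       (simp add: x_def)
  have norm: "(norm x)\<^sup>2 = z \<bullet> z"
    unfolding power2_norm_eq_inner by (simp add: inner_vec_def inner_complex_def x_def)
  have "?f x \<le> logm ?C"
    unfolding logm_def using bdd \<open>x \<noteq> 0\<close> by (intro cSUP_upper) auto
  then have "((M *v z) \<bullet> z) / (z \<bullet> z) \<le> logm ?C" unfolding f unfolding inner norm .
  moreover have "0 < z \<bullet> z" using False by simp
  ultimately show ?thesis by (simp only: pos_divide_le_eq)
qed simp

text \<open>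
The function \<open>exp (- 2 L s) \<parallel>z s\<parallel>\<^sup>2\<close> is nonincreasing.
\<close>
lemma gronwall_norm:
  fixes z z' :: "real \<Rightarrow> 'a::real_inner"
  assumes z: "\<And>t. t \<in> {0..T} \<Longrightarrow> (z has_vector_derivative z' t) (at t within {0..T})"
    and le: "\<And>t. t \<in> {0..T} \<Longrightarrow> z' t \<bullet> z t \<le> L * (z t \<bullet> z t)"
    and t: "t \<in> {0..T}"
  shows "norm (z t) \<le> exp (L * t) * norm (z 0)"
proof -
  define f where "f s = exp (- 2 * L * s) * (z s \<bullet> z s)" for s
  define f' where "f' s = 2 * exp (- 2 * L * s) * (z' s \<bullet> z s - L * (z s \<bullet> z s))" for s
  have der: "(f has_derivative (\<lambda>h. h * f' s)) (at s within {0..t})" if s: "0 \<le> s" "s \<le> t" for s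
  proof -
    have "(z has_derivative (\<lambda>h. h *\<^sub>R z' s)) (at s within {0..t})"
      using z[of s] t s has_derivative_subset[of z _ s "{0..T}" "{0..t}"]
      unfolding has_vector_derivative_def by auto
    then show ?thesis
      unfolding f_def f'_def
      by (auto intro!: derivative_eq_intros simp: fun_eq_iff algebra_simps inner_commute)
  qed
  obtain s where s: "s \<in> {0..t}" "f t - f 0 = (t - 0) * f' s"
    using mvt_very_simple[of 0 t f "\<lambda>s h. h * f' s"] der t by auto
  have "f' s \<le> 0"
    unfolding f'_def using le[of s] s(1) t by (intro mult_nonneg_nonpos) auto
  then have "f t \<le> f 0" using s t mult_nonneg_nonpos[of t "f' s"] by simp
  then have "exp (- (2 * (L * t))) * (norm (z t))\<^sup>2 \<le> (norm (z 0))\<^sup>2"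
    by (simp add: f_def power2_norm_eq_inner mult.assoc)
  then have "(norm (z t))\<^sup>2 \<le> exp (2 * (L * t)) * (norm (z 0))\<^sup>2"
    by (simp add: exp_minus field_simps)
  also have "\<dots> = (exp (L * t) * norm (z 0))\<^sup>2"
    by (simp add: power_mult_distrib exp_double)
  finally show ?thesis by (rule power2_le_imp_le) simp
qed

text \<open>
The difference \<open>w - y\<close> has derivative \<open>f(w) (w - y) + (f(w) - f(y)) y\<close>. The first term is controlled
by the logarithmic norm, the second by the Lipschitz constant and the bound on \<open>\<Omega>\<close>.
\<close>
lemma trajectory_divergence:
  fixes f :: "real^'d \<Rightarrow> real^'d^'d"
  assumes y: "\<And>t. t \<in> {0..T} \<Longrightarrow> (y has_vector_derivative f (y t) *v y t) (at t within {0..T})"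
      "\<And>t. t \<in> {0..T} \<Longrightarrow> y t \<in> \<Omega>"
    and w: "\<And>t. t \<in> {0..T} \<Longrightarrow> (w has_vector_derivative f (w t) *v w t) (at t within {0..T})"
      "\<And>t. t \<in> {0..T} \<Longrightarrow> w t \<in> \<Omega>"
    and K: "0 \<le> K" and lip: "\<And>x z. x \<in> \<Omega> \<Longrightarrow> z \<in> \<Omega> \<Longrightarrow> opnorm (f x - f z) \<le> K * norm (x - z)"
    and bdd1: "bdd_above ((\<lambda>x. logm (complex_mat (f x))) ` \<Omega>)"
    and bdd2: "bdd_above (norm ` \<Omega>)"
    and L: "L = (SUP x\<in>\<Omega>. logm (complex_mat (f x))) + K * (SUP x\<in>\<Omega>. norm x)"
    and t: "t \<in> {0..T}"
  shows "norm (w t - y t) \<le> exp (L * t) * norm (w 0 - y 0)"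
proof (rule gronwall_norm[where z = "\<lambda>t. w t - y t", OF _ _ t])
  fix s assume s: "s \<in> {0..T}"
  let ?d = "w s - y s" and ?l = "SUP x\<in>\<Omega>. logm (complex_mat (f x))" and ?r = "SUP x\<in>\<Omega>. norm x"
  show "((\<lambda>t. w t - y t) has_vector_derivative f (w s) *v w s - f (y s) *v y s) (at s within {0..T})"
    by (rule has_vector_derivative_diff[OF w(1)[OF s] y(1)[OF s]])
  have "(f (w s) *v w s - f (y s) *v y s) \<bullet> ?d
      = (f (w s) *v ?d) \<bullet> ?d + ((f (w s) - f (y s)) *v y s) \<bullet> ?d"
    by (simp add: matrix_vector_mult_diff_distrib matrix_vector_mult_diff_rdistrib inner_diff_left)
  also have "(f (w s) *v ?d) \<bullet> ?d \<le> ?l * (?d \<bullet> ?d)"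
  proof -
    have "logm (complex_mat (f (w s))) \<le> ?l" using bdd1 w(2)[OF s] by (intro cSUP_upper)
    then show ?thesis
      using inner_le_logm[of "f (w s)" ?d] mult_right_mono[OF _ inner_ge_zero[of ?d]] order_trans by blast
  qed
  also have "((f (w s) - f (y s)) *v y s) \<bullet> ?d \<le> K * ?r * (?d \<bullet> ?d)"
  proof -
    have r: "norm (y s) \<le> ?r" using bdd2 y(2)[OF s] by (intro cSUP_upper)
    have "((f (w s) - f (y s)) *v y s) \<bullet> ?d \<le> norm ((f (w s) - f (y s)) *v y s) * norm ?d"
      by (rule norm_cauchy_schwarz)
    also have "\<dots> \<le> (opnorm (f (w s) - f (y s)) * norm (y s)) * norm ?d"
      by (intro mult_right_mono opnorm_bound norm_ge_zero)
    also have "\<dots> \<le> (K * norm ?d * ?r) * norm ?d"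
      using r lip[OF w(2)[OF s] y(2)[OF s]] K by (intro mult_right_mono mult_mono) auto
    also have "\<dots> = K * ?r * (?d \<bullet> ?d)" by (simp add: dot_square_norm power2_eq_square)
    finally show ?thesis .
  qed
  finally show "(f (w s) *v w s - f (y s) *v y s) \<bullet> ?d \<le> L * (?d \<bullet> ?d)"
    by (simp add: L algebra_simps)
qed

section \<open>Reuse of a feedback along a neighbouring trajectory\<close>

theorem proposition3p5:
  fixes A :: "real^'d \<Rightarrow> real^'d^'d"
    and B :: "real^'m^'d"
    and Q :: "real^'d^'d"
    and R :: "real^'m^'m"
    and F :: "real^'d^'d"
    and P Acl :: "real^'d \<Rightarrow> real^'d^'d"
    and \<Omega> :: "(real^'d) set"
    and Params :: "real set"
    and y0 :: "real \<Rightarrow> real^'d"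
    and y :: "real \<Rightarrow> real \<Rightarrow> real^'d"
    and H :: "real \<Rightarrow> real \<Rightarrow> real^'d^'d"
    and T L Lcl LA Ly0 \<mu> \<mu>' \<Delta>\<mu> :: real
  assumes T_pos: "T > 0"
    and domain: "is_domain \<Omega>"
    and Q_psd: "sym_psd Q"
    and R_pd: "sym_pd R"
    and F_eq: "F = B ** matrix_inv R ** transpose B"
    and P_eq: "\<And>x. x \<in> \<Omega> \<Longrightarrow> P x = riccati_sol (A x) F Q"
    and Acl_eq: "\<And>x. x \<in> \<Omega> \<Longrightarrow> Acl x = A x - F ** P x"
    and y_init: "\<And>\<nu>. \<nu> \<in> Params \<Longrightarrow> y \<nu> 0 = y0 \<nu>"
    and y_ode: "\<And>\<nu> t. \<nu> \<in> Params \<Longrightarrow> t \<in> {0..T} \<Longrightarrow>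
          (y \<nu> has_vector_derivative Acl (y \<nu> t) *v y \<nu> t) (at t within {0..T})"
    and y_in: "\<And>\<nu> t. \<nu> \<in> Params \<Longrightarrow> t \<in> {0..T} \<Longrightarrow> y \<nu> t \<in> \<Omega>"
    and H_eq: "\<And>\<nu> t. \<nu> \<in> Params \<Longrightarrow> t \<in> {0..T} \<Longrightarrow>
          H \<nu> t = lyapunov_sol (A (y \<nu> t) - F ** P (y \<nu> t)) (- mat 1)"
    and a_pos: "Lcl > 0"
    and a: "\<And>x z. x \<in> \<Omega> \<Longrightarrow> z \<in> \<Omega> \<Longrightarrow> opnorm (Acl x - Acl z) \<le> Lcl * norm (x - z)"
    and b: "\<And>x. x \<in> \<Omega> \<Longrightarrow> stabilizable (A x) B"
    and c: "\<And>x. x \<in> \<Omega> \<Longrightarrow> detectable (A x) (psd_sqrt Q)"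
    and d_pos: "Ly0 > 0"
    and d: "Ly0-lipschitz_on Params y0"
    and e_pos: "LA > 0"
    and e: "\<And>x z. x \<in> \<Omega> \<Longrightarrow> z \<in> \<Omega> \<Longrightarrow> opnorm (A x - A z) \<le> LA * norm (x - z)"
    and max1: "bdd_above ((\<lambda>x. logm (complex_mat (Acl x))) ` \<Omega>)"
    and max2: "bdd_above (norm ` \<Omega>)"
    and L_eq: "L = (SUP x\<in>\<Omega>. logm (complex_mat (Acl x))) + Lcl * (SUP x\<in>\<Omega>. norm x)"
    and mu: "\<mu> \<in> Params"
    and mu': "\<mu>' = \<mu> + \<Delta>\<mu>" "\<mu>' \<in> Params"
    and Dmu: "\<Delta>\<mu> > 0"
  shows "(\<Delta>\<mu> < 1 / (2 * LA * Ly0 * opnorm (H \<mu> 0)) \<longrightarrow>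
            stable_mat (A (y \<mu>' 0) - F ** P (y \<mu> 0)))
       \<and> (\<Delta>\<mu> < 1 / (2 * LA * Ly0 * opnorm (H \<mu> 0)) \<longrightarrow>
          (\<forall>t\<in>{0<..T}. L < - (1 / t) * ln (2 * LA * Ly0 * \<Delta>\<mu> * opnorm (H \<mu> t))) \<longrightarrow>
            (\<forall>t\<in>{0..T}. stable_mat (A (y \<mu>' t) - F ** P (y \<mu> t))))
       \<and> (\<Delta>\<mu> < 1 / (2 * LA * Ly0 * opnorm (H \<mu> 0)) \<longrightarrow>
          (\<forall>t\<in>{0<..T}. L < - (1 / t) * ln (2 * LA * Ly0 * \<Delta>\<mu> * opnorm (H \<mu> t))) \<longrightarrow>
            (\<forall>t\<in>{0..T}.
               let A' = A (y \<mu>' t);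
                   S = newton_kleinman A' F Q (P (y \<mu> t))
               in (\<forall>k. \<exists>!X. lyapunov_eq (A' - F ** S k) (- (S k ** F ** S k) - Q) X)
                \<and> (\<exists>!X. sym_psd X \<and> riccati_eq A' F Q X)
                \<and> S \<longlonglongrightarrow> P (y \<mu>' t)
                \<and> sym_psd (P (y \<mu>' t)) \<and> riccati_eq A' F Q (P (y \<mu>' t))))"
proof -
  interpret riccati_data B Q R F
    by unfold_locales (fact Q_psd R_pd F_eq)+
  have riccati: "sym_psd (P x)" "riccati_eq (A x) F Q (P x)" "stable_mat (A x - F ** P x)"
    if "x \<in> \<Omega>" for x
    using riccati_sol_props[OF b[OF that] c[OF that]] P_eq[OF that] by simp_all
  \<comment> \<open>the common form of the two smallness hypotheses: the first is the case \<open>t = 0\<close>,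
      the second, freed of the logarithm, the case \<open>t > 0\<close>\<close>
  have stable: "stable_mat (A (y \<mu>' t) - F ** P (y \<mu> t))"
    if t: "t \<in> {0..T}" and small: "exp (L * t) * (2 * LA * Ly0 * \<Delta>\<mu> * opnorm (H \<mu> t)) < 1" for t
  proof (rule stable_mat_perturb)
    let ?M = "A (y \<mu> t) - F ** P (y \<mu> t)"
    have in\<Omega>: "y \<mu> t \<in> \<Omega>" "y \<mu>' t \<in> \<Omega>" using y_in mu mu' t by blast+
    show "stable_mat ?M" by (rule riccati(3)[OF in\<Omega>(1)])
    have "norm (y \<mu>' t - y \<mu> t) \<le> exp (L * t) * norm (y \<mu>' 0 - y \<mu> 0)"
      by (rule trajectory_divergence[OF y_ode[OF mu] y_in[OF mu] y_ode[OF mu'(2)] y_in[OF mu'(2)]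
            less_imp_le[OF a_pos] a max1 max2 L_eq t])
    also have "norm (y \<mu>' 0 - y \<mu> 0) \<le> Ly0 * \<Delta>\<mu>"
      using lipschitz_onD[OF d mu'(2) mu] Dmu
      by (simp add: y_init mu mu'(2) dist_norm) (simp add: mu'(1))
    finally have dist: "norm (y \<mu>' t - y \<mu> t) \<le> exp (L * t) * (Ly0 * \<Delta>\<mu>)" by simp
    have "opnorm (A (y \<mu>' t) - F ** P (y \<mu> t) - ?M) = opnorm (A (y \<mu>' t) - A (y \<mu> t))" by simp
    also have "\<dots> \<le> LA * norm (y \<mu>' t - y \<mu> t)" by (rule e[OF in\<Omega>(2,1)])
    also have "\<dots> \<le> LA * (exp (L * t) * (Ly0 * \<Delta>\<mu>))"
      using dist e_pos by (intro mult_left_mono) auto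
    finally have "2 * opnorm (A (y \<mu>' t) - F ** P (y \<mu> t) - ?M) * opnorm (H \<mu> t)
        \<le> 2 * (LA * (exp (L * t) * (Ly0 * \<Delta>\<mu>))) * opnorm (H \<mu> t)"
      by (intro mult_right_mono mult_left_mono opnorm_nonneg) auto
    also have "\<dots> < 1" using small by (simp add: mult_ac)
    finally show "2 * opnorm (A (y \<mu>' t) - F ** P (y \<mu> t) - ?M) * opnorm (lyapunov_sol ?M (- mat 1)) < 1"
      by (simp only: H_eq[OF mu t])
  qed
  have Hpos: "0 < opnorm (H \<mu> t)" if "t \<in> {0..T}" for t
    using lyapunov_identity(3)[OF riccati(3)[OF y_in[OF mu that]]] H_eq[OF mu that] by simp
  have i: "stable_mat (A (y \<mu>' 0) - F ** P (y \<mu> 0))"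
    if "\<Delta>\<mu> < 1 / (2 * LA * Ly0 * opnorm (H \<mu> 0))"
  proof (rule stable)
    have "0 < 2 * LA * Ly0 * opnorm (H \<mu> 0)"
      using e_pos d_pos Hpos[of 0] T_pos by simp
    then show "exp (L * 0) * (2 * LA * Ly0 * \<Delta>\<mu> * opnorm (H \<mu> 0)) < 1"
      using that by (simp add: pos_less_divide_eq mult_ac)
  qed (use T_pos in simp)
  have ii: "stable_mat (A (y \<mu>' t) - F ** P (y \<mu> t))"
    if 1: "\<Delta>\<mu> < 1 / (2 * LA * Ly0 * opnorm (H \<mu> 0))"
      and 2: "\<forall>t\<in>{0<..T}. L < - (1 / t) * ln (2 * LA * Ly0 * \<Delta>\<mu> * opnorm (H \<mu> t))"
      and t: "t \<in> {0..T}" for t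
  proof (cases "t = 0")
    case True
    then show ?thesis using i[OF 1] by simp
  next
    case False
    then have tpos: "0 < t" using t by simp
    let ?c = "2 * LA * Ly0 * \<Delta>\<mu> * opnorm (H \<mu> t)"
    have c: "0 < ?c" using e_pos d_pos Dmu Hpos[OF t] by simp
    have "L < - (1 / t) * ln ?c" using 2 t tpos by auto
    then have "L * t < - ln ?c" using tpos by (simp add: field_simps)
    then have "exp (L * t) < exp (- ln ?c)" by simp
    also have "\<dots> = 1 / ?c" using c by (simp only: exp_minus exp_ln inverse_eq_divide)
    finally have "exp (L * t) * ?c < 1" using c by (simp only: pos_less_divide_eq)
    then show ?thesis by (rule stable[OF t])
  qed
  have iii: "let A' = A (y \<mu>' t); S = newton_kleinman A' F Q (P (y \<mu> t))
      in (\<forall>k. \<exists>!X. lyapunov_eq (A' - F ** S k) (- (S k ** F ** S k) - Q) X)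
        \<and> (\<exists>!X. sym_psd X \<and> riccati_eq A' F Q X)
        \<and> S \<longlonglongrightarrow> P (y \<mu>' t)
        \<and> sym_psd (P (y \<mu>' t)) \<and> riccati_eq A' F Q (P (y \<mu>' t))"
    if t: "t \<in> {0..T}" and st: "stable_mat (A (y \<mu>' t) - F ** P (y \<mu> t))" for t
  proof -
    have in\<Omega>: "y \<mu> t \<in> \<Omega>" "y \<mu>' t \<in> \<Omega>" using y_in mu mu' t by blast+
    have sym: "transpose (P (y \<mu> t)) = P (y \<mu> t)" using riccati(1)[OF in\<Omega>(1)] by (simp add: sym_psd_def)
    note bc = b[OF in\<Omega>(2)] c[OF in\<Omega>(2)]
    show ?thesis
      unfolding Let_def
      using lyapunov_ex1 newton_kleinman_invariant[OF sym st] riccati_ex1[OF bc]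
        newton_kleinman_tendsto[OF bc sym st] riccati(1,2)[OF in\<Omega>(2)] P_eq[OF in\<Omega>(2)] by metis
  qed
  show ?thesis using i ii iii by blast
qed

end
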